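(* Let $\mathcal{Z}_{\mathrm{simple}} = \{q \in \mathbb{C} : \operatorname{Rel}(G;q) = 0 \text{ for some connected simple graph } G\}$ and let $\mathbb{D}$ denote the open unit disk in $\mathbb{C}$. Then: (1) $\overline{\mathbb{D}} \subseteq \overline{\mathcal{Z}_{\mathrm{simple}}}$, i.e. reliability roots of simple graphs are dense in the unit disk. (2) $\mathcal{Z}_{\mathrm{simple}} \cap \mathbb{R}$ is dense in $[-1,0]$, and consequently $\overline{\mathcal{Z}_{\mathrm{simple}} \cap \mathbb{R}} = [-1,0] \cup \{1\}$.
   Context: For a connected (multi)graph $G=(V,E)$, the (all-terminal) reliability polynomial is $\operatorname{Rel}(G;q) = \sum_{S \subseteq E,\ (V,S)\text{ connected}} (1-q)^{|S|} q^{|E|-|S|}$, a polynomial in $q$. A reliability root of $G$ is a complex zero of this polynomial. Overlines denote topological closure in $\mathbb{C}$. *)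

theory Defs
  imports "HOL-Analysis.Analysis" "HOL-Computational_Algebra.Polynomial"
begin

text \<open>A finite simple graph is given by its vertex set and its edge set, an edge being the
  two-element set of its endpoints.\<close>

definition simple_graph :: "'a set \<Rightarrow> 'a set set \<Rightarrow> bool" where
  "simple_graph V E \<longleftrightarrow> finite V \<and> (\<forall>e\<in>E. e \<subseteq> V \<and> card e = 2)"

text \<open>The null graph (without vertices) does not count as connected.\<close>

definition connected_graph :: "'a set \<Rightarrow> 'a set set \<Rightarrow> bool" where
  "connected_graph V E \<longleftrightarrow> V \<noteq> {} \<and> (\<forall>u\<in>V. \<forall>v\<in>V. (u, v) \<in> {(x, y). {x, y} \<in> E}\<^sup>*)"

text \<open>In the indeterminate \<open>q\<close>, \<open>[:1, -1:]\<close> is \<open>1 - q\<close> and \<open>[:0, 1:]\<close> is \<open>q\<close>.\<close>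

definition rel_poly :: "'a set \<Rightarrow> 'a set set \<Rightarrow> complex poly" where
  "rel_poly V E =
    (\<Sum>S | S \<subseteq> E \<and> connected_graph V S. [:1, -1:] ^ card S * [:0, 1:] ^ (card E - card S))"

text \<open>Every finite graph is isomorphic to one whose vertices are natural numbers.\<close>

definition Z_simple :: "complex set" where
  "Z_simple = {q. \<exists>(V :: nat set) E.
     simple_graph V E \<and> connected_graph V E \<and> poly (rel_poly V E) q = 0}"

end

theory Submission
  imports Defs "HOL-Complex_Analysis.Great_Picard"
begin

text \<open>
  With \<open>w = (1 - q) / q\<close> one has \<open>Rel(G; q) = q ^ card E * C_G(w)\<close>, where \<open>C_G(w)\<close> is the sum of
  \<open>w ^ card S\<close> over the connected spanning edge sets \<open>S\<close>.

  Real roots: for real \<open>q\<close> with \<open>\<bar>q\<bar> > 1\<close> we have \<open>-2 < w < 0\<close>. Removing a vertex \<open>r\<close> and summing over the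
  component \<open>A\<close> of another vertex in \<open>S - r\<close> expresses \<open>C_V\<close> as the sum of
  \<open>C_A * ((1 + w) ^ d - 1) * C_{V - A}\<close>, where \<open>d\<close> is the number of edges between \<open>r\<close> and \<open>A\<close>; by
  induction all summands have the sign \<open>(-1) ^ (card V - 1)\<close>.

  Density: a cycle of \<open>N + 1\<close> bundles of \<open>k\<close> parallel edges has the factor \<open>1 + N * q ^ k\<close> in its
  reliability polynomial, and the zeros of these factors are dense in the unit disk (for odd \<open>k\<close>, the
  real ones are dense in \<open>[-1, 0]\<close>). To make the graph simple, each edge is put in series with a large
  clique. Inside the unit disk a clique behaves like a single vertex as its size grows, so the
  corresponding factor converges to \<open>1 + N * q ^ k\<close> locally uniformly, and Hurwitz's theorem (the
  intermediate value theorem for real roots) gives zeros nearby.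
\<close>

subsection \<open>Connectedness and generating functions of edge sets\<close>

text \<open>No edge of \<open>S\<close> leaves \<open>U\<close>, so \<open>U\<close> is a union of
  components. Testing cuts instead of paths lets subgraphs be glued by plain set operations; the
  complement of an uncut set is again uncut.\<close>

definition uncut :: "'a set set \<Rightarrow> 'a set \<Rightarrow> bool" where
  "uncut S U \<longleftrightarrow> (\<forall>x y. {x, y} \<in> S \<longrightarrow> (x \<in> U \<longleftrightarrow> y \<in> U))"

lemma uncutD: "uncut S U \<Longrightarrow> {x, y} \<in> S \<Longrightarrow> x \<in> U \<longleftrightarrow> y \<in> U"
  by (auto simp: uncut_def)

lemma uncut_Un: "uncut (S \<union> T) U \<longleftrightarrow> uncut S U \<and> uncut T U"
  by (auto simp: uncut_def)

lemma uncut_insert: "uncut (insert {s, t} S) U \<longleftrightarrow> (s \<in> U \<longleftrightarrow> t \<in> U) \<and> uncut S U"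
  by (auto simp: uncut_def doubleton_eq_iff)

lemma uncut_Compl: "uncut S (- U) \<longleftrightarrow> uncut S U"
  by (auto simp: uncut_def)

lemma uncut_cong: "S \<subseteq> Pow V \<Longrightarrow> U \<inter> V = U' \<inter> V \<Longrightarrow> uncut S U \<longleftrightarrow> uncut S U'"
proof -
  assume *: "S \<subseteq> Pow V" "U \<inter> V = U' \<inter> V"
  have "x \<in> U \<longleftrightarrow> x \<in> U'" if "x \<in> V" for x using *(2) that by blast
  then have "(x \<in> U \<longleftrightarrow> y \<in> U) \<longleftrightarrow> (x \<in> U' \<longleftrightarrow> y \<in> U')" if "{x, y} \<in> S" for x y
    using *(1) that by blast
  then show ?thesis unfolding uncut_def by simp
qed

lemma uncut_subset: "uncut S U \<Longrightarrow> T \<subseteq> S \<Longrightarrow> uncut T U"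
  by (auto simp: uncut_def)

lemma uncut_full: "S \<subseteq> Pow V \<Longrightarrow> V \<subseteq> U \<or> V \<inter> U = {} \<Longrightarrow> uncut S U"
  unfolding uncut_def by blast

text \<open>Membership in an uncut set propagates along paths, and conversely the set of vertices
  reachable from \<open>u\<close> is itself uncut.\<close>

lemma connected_graph_iff:
  "connected_graph V S \<longleftrightarrow> V \<noteq> {} \<and> (\<forall>U. uncut S U \<longrightarrow> V \<subseteq> U \<or> V \<inter> U = {})"
proof
  assume c: "connected_graph V S"
  have "x \<in> U \<longleftrightarrow> y \<in> U" if "uncut S U" "(x, y) \<in> {(x, y). {x, y} \<in> S}\<^sup>*" for U x y
    using that(2) by induction (use that(1) in \<open>auto simp: uncut_def\<close>)
  then show "V \<noteq> {} \<and> (\<forall>U. uncut S U \<longrightarrow> V \<subseteq> U \<or> V \<inter> U = {})"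
    using c unfolding connected_graph_def by blast
next
  assume *: "V \<noteq> {} \<and> (\<forall>U. uncut S U \<longrightarrow> V \<subseteq> U \<or> V \<inter> U = {})"
  have "(u, v) \<in> {(x, y). {x, y} \<in> S}\<^sup>*" if "u \<in> V" "v \<in> V" for u v
  proof -
    let ?U = "{v. (u, v) \<in> {(x, y). {x, y} \<in> S}\<^sup>*}"
    have "uncut S ?U"
      unfolding uncut_def
      by (auto intro: rtrancl_into_rtrancl simp: insert_commute)
    then show ?thesis using * that by blast
  qed
  with * show "connected_graph V S" by (auto simp: connected_graph_def)
qed

lemma connected_graphD:
  "connected_graph V S \<Longrightarrow> uncut S U \<Longrightarrow> x \<in> V \<Longrightarrow> x \<in> U \<Longrightarrow> V \<subseteq> U"
  by (auto simp: connected_graph_iff)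

text \<open>The component of \<open>r\<close> is the least uncut set containing it, obtained as an
  intersection.\<close>

lemma component_exists:
  assumes "S \<subseteq> Pow V" "r \<in> V"
  shows "\<exists>A. r \<in> A \<and> A \<subseteq> V \<and> uncut S A \<and> connected_graph A (S \<inter> Pow A)"
proof -
  define A where "A = \<Inter>{W. r \<in> W \<and> uncut S W}"
  have r: "r \<in> A" by (auto simp: A_def)
  have AV: "A \<subseteq> V" using uncut_full[OF assms(1), of V] assms(2) by (auto simp: A_def)
  have stA: "uncut S A" unfolding uncut_def A_def by (auto simp: uncut_def)
  have min: "A \<subseteq> W" if "r \<in> W" "uncut S W" for W using that by (auto simp: A_def)
  \<comment> \<open>A cut \<open>U\<close> of the inner edges splits \<open>A\<close> into two sets
    that are both uncut in all of \<open>S\<close>. The one containing \<open>r\<close> is all of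
    \<open>A\<close> by minimality.\<close>
  have "A \<subseteq> U \<or> A \<inter> U = {}" if U: "uncut (S \<inter> Pow A) U" for U
  proof -
    have "uncut S (A \<inter> U)" "uncut S (A - U)"
      using stA U unfolding uncut_def by auto
    with min[of "A \<inter> U"] min[of "A - U"] r show ?thesis by blast
  qed
  then have "connected_graph A (S \<inter> Pow A)" using r by (auto simp: connected_graph_iff)
  with r AV stA show ?thesis by blast
qed

text \<open>Each of the two sets is connected and meets the other, which is uncut, in
  \<open>r\<close>; so each lies inside the other.\<close>

lemma component_unique:
  assumes "r \<in> A" "uncut S A" "connected_graph A (S \<inter> Pow A)"
    and "r \<in> B" "uncut S B" "connected_graph B (S \<inter> Pow B)"
  shows "A = B"
proof
  show "A \<subseteq> B" using connected_graphD[OF assms(3) uncut_subset[OF assms(5)]] assms by blast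
  show "B \<subseteq> A" using connected_graphD[OF assms(6) uncut_subset[OF assms(2)]] assms by blast
qed

text \<open>The property \<open>Q\<close> is kept arbitrary so that one product rule and one sum
  rule serve connected, splitting and nonempty edge sets alike. The ring is arbitrary so that real
  and complex weights are treated together.\<close>

definition subset_gf :: "('e set \<Rightarrow> bool) \<Rightarrow> 'e set \<Rightarrow> 'b::comm_ring_1 \<Rightarrow> 'b" where
  "subset_gf Q E w = (\<Sum>S | S \<subseteq> E \<and> Q S. w ^ card S)"

text \<open>A subset of a disjoint union is a pair of independent choices, and the weight is
  multiplicative.\<close>

lemma subset_gf_mult:
  assumes fin: "finite E1" "finite E2" and disj: "E1 \<inter> E2 = {}"
    and Q: "\<And>S1 S2. S1 \<subseteq> E1 \<Longrightarrow> S2 \<subseteq> E2 \<Longrightarrow> Q (S1 \<union> S2) \<longleftrightarrow> Q1 S1 \<and> Q2 S2"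
  shows "subset_gf Q (E1 \<union> E2) w = subset_gf Q1 E1 w * subset_gf Q2 E2 w"
proof -
  have "subset_gf Q1 E1 w * subset_gf Q2 E2 w =
     (\<Sum>(S1, S2)\<in>{S. S \<subseteq> E1 \<and> Q1 S} \<times> {S. S \<subseteq> E2 \<and> Q2 S}. w ^ card S1 * w ^ card S2)"
    unfolding subset_gf_def by (simp add: sum_product sum.cartesian_product)
  also have "\<dots> = subset_gf Q (E1 \<union> E2) w"
    unfolding subset_gf_def
  proof (rule sum.reindex_bij_witness[where i = "\<lambda>S. (S \<inter> E1, S \<inter> E2)" and j = "\<lambda>(S1, S2). S1 \<union> S2"])
    fix a assume a: "a \<in> {S. S \<subseteq> E1 \<and> Q1 S} \<times> {S. S \<subseteq> E2 \<and> Q2 S}"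
    then obtain S1 S2 where [simp]: "a = (S1, S2)" and s: "S1 \<subseteq> E1" "S2 \<subseteq> E2" "Q1 S1" "Q2 S2"
      by auto
    show "((case a of (S1, S2) \<Rightarrow> S1 \<union> S2) \<inter> E1, (case a of (S1, S2) \<Rightarrow> S1 \<union> S2) \<inter> E2) = a"
      using s disj by auto
    show "(case a of (S1, S2) \<Rightarrow> S1 \<union> S2) \<in> {S. S \<subseteq> E1 \<union> E2 \<and> Q S}"
      using s Q by auto
    have "card (S1 \<union> S2) = card S1 + card S2"
      using s disj fin by (intro card_Un_disjoint) (auto intro: finite_subset)
    then show "w ^ card (case a of (S1, S2) \<Rightarrow> S1 \<union> S2) =
        (case a of (S1, S2) \<Rightarrow> w ^ card S1 * w ^ card S2)"
      by (simp add: power_add)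
  next
    fix S assume S: "S \<in> {S. S \<subseteq> E1 \<union> E2 \<and> Q S}"
    then have eq: "S \<inter> E1 \<union> S \<inter> E2 = S" by auto
    then show "(case (S \<inter> E1, S \<inter> E2) of (S1, S2) \<Rightarrow> S1 \<union> S2) = S" by simp
    show "(S \<inter> E1, S \<inter> E2) \<in> {S. S \<subseteq> E1 \<and> Q1 S} \<times> {S. S \<subseteq> E2 \<and> Q2 S}"
      using S Q[of "S \<inter> E1" "S \<inter> E2"] eq by auto
  qed
  finally show ?thesis ..
qed

text \<open>\<open>R\<close> attaches to every \<open>Q\<close>-set exactly one label in
  \<open>I\<close>, typically a component, so the labels partition the sum.\<close>

lemma subset_gf_sum:
  assumes "finite E" "finite I"
    and "\<And>S. S \<subseteq> E \<Longrightarrow> Q S \<Longrightarrow> \<exists>A\<in>I. R A S"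
    and "\<And>S A. S \<subseteq> E \<Longrightarrow> A \<in> I \<Longrightarrow> R A S \<Longrightarrow> Q S"
    and "\<And>S A B. S \<subseteq> E \<Longrightarrow> A \<in> I \<Longrightarrow> B \<in> I \<Longrightarrow> R A S \<Longrightarrow> R B S \<Longrightarrow> A = B"
  shows "subset_gf Q E w = (\<Sum>A\<in>I. subset_gf (R A) E w)"
proof -
  have "{S. S \<subseteq> E \<and> Q S} = (\<Union>A\<in>I. {S. S \<subseteq> E \<and> R A S})"
    using assms(3,4) by (intro set_eqI iffI; simp) metis+
  then have "subset_gf Q E w = (\<Sum>S\<in>(\<Union>A\<in>I. {S. S \<subseteq> E \<and> R A S}). w ^ card S)"
    by (simp add: subset_gf_def)
  also have "\<dots> = (\<Sum>A\<in>I. subset_gf (R A) E w)"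
    unfolding subset_gf_def
  proof (intro sum.UNION_disjoint ballI impI)
    show "finite {S. S \<subseteq> E \<and> R A S}" for A
      by (rule finite_subset[of _ "Pow E"]) (use assms(1) in auto)
  qed (use assms(2,5) in auto)
  finally show ?thesis .
qed

lemma subset_gf_cong:
  "(\<And>S. S \<subseteq> E \<or> S \<subseteq> E' \<Longrightarrow> S \<subseteq> E \<and> Q S \<longleftrightarrow> S \<subseteq> E' \<and> Q' S) \<Longrightarrow> subset_gf Q E w = subset_gf Q' E' w"
  unfolding subset_gf_def by (rule sum.cong) auto

lemma subset_gf_all:
  assumes "finite E"
  shows "subset_gf (\<lambda>_. True) E w = (1 + w) ^ card E"
proof -
  have "(\<Prod>e\<in>E. w + 1) = (\<Sum>S\<in>Pow E. (\<Prod>e\<in>S. w) * (\<Prod>e\<in>E - S. 1))"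
    by (rule prod_add[OF assms])
  then show ?thesis by (simp add: subset_gf_def Pow_def add.commute)
qed

lemma subset_gf_nonempty:
  assumes "finite E"
  shows "subset_gf (\<lambda>S. S \<noteq> {}) E w = (1 + w) ^ card E - 1"
proof -
  have "(1 + w) ^ card E = (\<Sum>S\<in>Pow E. w ^ card S)"
    using subset_gf_all[OF assms, of w] by (simp add: subset_gf_def Pow_def)
  also have "\<dots> = 1 + (\<Sum>S\<in>Pow E - {{}}. w ^ card S)"
    using assms by (subst sum.remove[of _ "{}"]) auto
  also have "Pow E - {{}} = {S. S \<subseteq> E \<and> S \<noteq> {}}" by auto
  finally show ?thesis by (simp add: subset_gf_def)
qed

lemma subset_gf_of_real:
  "subset_gf Q E (of_real w :: 'b::{real_algebra_1, comm_ring_1}) = of_real (subset_gf Q E w)"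
  by (simp add: subset_gf_def)

lemma poly_rel_poly:
  assumes "finite E" "q \<noteq> 0"
  shows "poly (rel_poly V E) q = q ^ card E * subset_gf (connected_graph V) E ((1 - q) / q)"
  unfolding rel_poly_def poly_sum subset_gf_def sum_distrib_left
proof (rule sum.cong[OF refl])
  fix S assume "S \<in> {S. S \<subseteq> E \<and> connected_graph V S}"
  then have "card S \<le> card E" using assms by (auto intro: card_mono)
  then show "poly ([:1, - 1:] ^ card S * [:0, 1:] ^ (card E - card S)) q =
     q ^ card E * ((1 - q) / q) ^ card S"
    using assms(2) power_diff[of q "card S" "card E"] by (simp add: power_divide)
qed

subsection \<open>Decomposition by components\<close>

abbreviation conn_gf :: "'a set \<Rightarrow> 'a set set \<Rightarrow> 'b::comm_ring_1 \<Rightarrow> 'b" where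
  "conn_gf V E \<equiv> subset_gf (connected_graph V) E"

lemma simple_graph_induced: "simple_graph V E \<Longrightarrow> A \<subseteq> V \<Longrightarrow> simple_graph A (E \<inter> Pow A)"
  by (auto simp: simple_graph_def intro: finite_subset)

lemma simple_graph_Pow: "simple_graph V E \<Longrightarrow> E \<subseteq> Pow V"
  by (auto simp: simple_graph_def)

lemma simple_graph_finite: "simple_graph V E \<Longrightarrow> finite V \<and> finite E"
  by (auto simp: simple_graph_def intro: finite_subset[of E "Pow V"])

lemma simple_graph_edge:
  assumes "simple_graph V E" "e \<in> E"
  obtains x y where "e = {x, y}" "x \<noteq> y" "x \<in> V" "y \<in> V"
  using assms by (auto simp: simple_graph_def card_2_iff)

lemma uncut_subset_Un:
  assumes "simple_graph V E" "S \<subseteq> E" "uncut S A"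
  shows "S \<subseteq> Pow A \<union> Pow (V - A)"
proof
  fix e assume "e \<in> S"
  then have "e \<in> E" using assms(2) by auto
  then obtain x y where "e = {x, y}" "x \<in> V" "y \<in> V"
    by (rule simple_graph_edge[OF assms(1)])
  with \<open>e \<in> S\<close> uncutD[OF assms(3), of x y] show "e \<in> Pow A \<union> Pow (V - A)" by auto
qed

lemma Pow_Compl_disjoint: "simple_graph V E \<Longrightarrow> E \<inter> Pow A \<inter> (E \<inter> Pow (V - A)) = {}"
proof -
  assume G: "simple_graph V E"
  \<comment> \<open>The only common member of the two power sets is the empty set, which is not an
    edge of a simple graph.\<close>
  have "e = {}" if "e \<subseteq> A" "e \<subseteq> V - A" for e using that by auto
  moreover have "{} \<notin> E" using G by (auto simp: simple_graph_def)
  ultimately show ?thesis by auto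
qed

lemma Pow_Compl_Int_Pow:
  assumes "simple_graph V E" "S \<subseteq> E \<inter> Pow (V - A)"
  shows "S \<inter> Pow A = {}"
proof -
  have "S \<inter> Pow A \<subseteq> E \<inter> Pow A \<inter> (E \<inter> Pow (V - A))" using assms(2) by auto
  then show ?thesis using Pow_Compl_disjoint[OF assms(1)] by simp
qed

text \<open>Once \<open>A\<close> is fixed as a component, no edge between \<open>A\<close> and
  \<open>V - A\<close> is chosen. The remaining choice splits into a connected edge set on
  \<open>A\<close> and an edge set on \<open>V - A\<close>, and \<open>Q\<close> may constrain only
  the latter.\<close>

lemma subset_gf_component:
  assumes G: "simple_graph V E"
    and Q: "\<And>S1 S2. S1 \<subseteq> E \<inter> Pow A \<Longrightarrow> connected_graph A S1 \<Longrightarrow> S2 \<subseteq> E \<inter> Pow (V - A)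
      \<Longrightarrow> Q (S1 \<union> S2) \<longleftrightarrow> Q' S2"
  shows "subset_gf (\<lambda>S. Q S \<and> uncut S A \<and> connected_graph A (S \<inter> Pow A)) E w =
    conn_gf A (E \<inter> Pow A) w * subset_gf Q' (E \<inter> Pow (V - A)) w"
proof -
  let ?R = "\<lambda>S. Q S \<and> uncut S A \<and> connected_graph A (S \<inter> Pow A)"
  have "subset_gf ?R E w = subset_gf ?R ((E \<inter> Pow A) \<union> (E \<inter> Pow (V - A))) w"
  proof (rule subset_gf_cong)
    fix S
    show "S \<subseteq> E \<and> ?R S \<longleftrightarrow> S \<subseteq> (E \<inter> Pow A) \<union> (E \<inter> Pow (V - A)) \<and> ?R S"
      using uncut_subset_Un[OF G, of S A] by auto
  qed
  also have "\<dots> = conn_gf A (E \<inter> Pow A) w * subset_gf Q' (E \<inter> Pow (V - A)) w"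
  proof (rule subset_gf_mult)
    fix S1 S2 assume S: "S1 \<subseteq> E \<inter> Pow A" "S2 \<subseteq> E \<inter> Pow (V - A)"
    have "(S1 \<union> S2) \<inter> Pow A = S1"
      using S(1) Pow_Compl_Int_Pow[OF G S(2)] by auto
    moreover have "uncut (S1 \<union> S2) A"
      unfolding uncut_Un using S by (intro conjI uncut_full[of S1 A] uncut_full[of S2 "V - A"]) auto
    ultimately show "?R (S1 \<union> S2) \<longleftrightarrow> connected_graph A S1 \<and> Q' S2"
      using Q[of S1 S2] S by auto
  qed (use simple_graph_finite[OF G] Pow_Compl_disjoint[OF G] in auto)
  finally show ?thesis .
qed

text \<open>All edge sets are classified by the component \<open>A\<close> of \<open>r\<close>; the
  edges outside \<open>A\<close> are then free. For cliques this becomes the recursion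
  \<open>clique_rel_sum\<close>.\<close>

lemma conn_gf_component_sum:
  assumes G: "simple_graph V E" and r: "r \<in> V"
  shows "(1 + w) ^ card E =
    (\<Sum>A | r \<in> A \<and> A \<subseteq> V. conn_gf A (E \<inter> Pow A) w * (1 + w) ^ card (E \<inter> Pow (V - A)))"
proof -
  have fin: "finite V" "finite E" using simple_graph_finite[OF G] by auto
  have "(1 + w) ^ card E = subset_gf (\<lambda>_. True) E w" using fin by (simp add: subset_gf_all)
  \<comment> \<open>The conjunct \<open>True\<close> puts the summands in the form required by
    \<open>subset_gf_component\<close>.\<close>
  also have "\<dots> = (\<Sum>A | r \<in> A \<and> A \<subseteq> V.
      subset_gf (\<lambda>S. True \<and> uncut S A \<and> connected_graph A (S \<inter> Pow A)) E w)"
  proof (rule subset_gf_sum)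
    fix S assume S: "S \<subseteq> E"
    show "\<exists>A\<in>{A. r \<in> A \<and> A \<subseteq> V}. True \<and> uncut S A \<and> connected_graph A (S \<inter> Pow A)"
      using component_exists[OF order.trans[OF S simple_graph_Pow[OF G]] r] by auto
  next
    fix S A B assume "A \<in> {A. r \<in> A \<and> A \<subseteq> V}" "B \<in> {A. r \<in> A \<and> A \<subseteq> V}"
      "True \<and> uncut S A \<and> connected_graph A (S \<inter> Pow A)"
      "True \<and> uncut S B \<and> connected_graph B (S \<inter> Pow B)"
    then show "A = B" using component_unique[of r A S B] by simp
  qed (use fin in auto)
  also have "\<dots> = (\<Sum>A | r \<in> A \<and> A \<subseteq> V.
      conn_gf A (E \<inter> Pow A) w * subset_gf (\<lambda>_. True) (E \<inter> Pow (V - A)) w)"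
    using G by (intro sum.cong refl subset_gf_component) auto
  finally show ?thesis using fin by (simp add: subset_gf_all)
qed

text \<open>An edge set that becomes connected only by adding \<open>{s, t}\<close> has exactly two
  components, the component \<open>A\<close> of \<open>s\<close> and the rest, which contains
  \<open>t\<close>.\<close>

lemma split_gf_sum:
  assumes G: "simple_graph V E" and st: "s \<in> V" "t \<in> V"
  shows "subset_gf (\<lambda>S. connected_graph V (insert {s, t} S) \<and> \<not> connected_graph V S) E w =
    (\<Sum>A | s \<in> A \<and> A \<subseteq> V - {t}.
      conn_gf A (E \<inter> Pow A) w * conn_gf (V - A) (E \<inter> Pow (V - A)) w)"
proof -
  let ?Q = "\<lambda>S. connected_graph V (insert {s, t} S) \<and> \<not> connected_graph V S"
  have fin: "finite V" "finite E" using simple_graph_finite[OF G] by auto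
  have "subset_gf ?Q E w = (\<Sum>A | s \<in> A \<and> A \<subseteq> V - {t}.
      subset_gf (\<lambda>S. ?Q S \<and> uncut S A \<and> connected_graph A (S \<inter> Pow A)) E w)"
  proof (rule subset_gf_sum)
    fix S assume S: "S \<subseteq> E" and Q: "?Q S"
    obtain A where A: "s \<in> A" "A \<subseteq> V" "uncut S A" "connected_graph A (S \<inter> Pow A)"
      using component_exists[OF order.trans[OF S simple_graph_Pow[OF G]] st(1)] by auto
    have "t \<notin> A"
    proof
      assume "t \<in> A"
      then have "uncut (insert {s, t} S) A" using A by (auto simp: uncut_insert)
      then have "A = V" using connected_graphD[of V "insert {s, t} S" A s] Q A st by auto
      moreover have "S \<inter> Pow V = S" using S simple_graph_Pow[OF G] by auto
      ultimately show False using A(4) Q by auto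
    qed
    with A have "A \<in> {A. s \<in> A \<and> A \<subseteq> V - {t}}" by auto
    with A Q show "\<exists>A\<in>{A. s \<in> A \<and> A \<subseteq> V - {t}}. ?Q S \<and> uncut S A \<and> connected_graph A (S \<inter> Pow A)"
      by (intro bexI[of _ A]) simp_all
  next
    fix S A B assume "A \<in> {A. s \<in> A \<and> A \<subseteq> V - {t}}" "B \<in> {A. s \<in> A \<and> A \<subseteq> V - {t}}"
      "?Q S \<and> uncut S A \<and> connected_graph A (S \<inter> Pow A)"
      "?Q S \<and> uncut S B \<and> connected_graph B (S \<inter> Pow B)"
    then show "A = B" using component_unique[of s A S B] by simp
  qed (use fin in auto)
  also have "\<dots> = (\<Sum>A | s \<in> A \<and> A \<subseteq> V - {t}.
      conn_gf A (E \<inter> Pow A) w * conn_gf (V - A) (E \<inter> Pow (V - A)) w)"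
  proof (intro sum.cong refl subset_gf_component[OF G])
    fix A S1 S2 assume A: "A \<in> {A. s \<in> A \<and> A \<subseteq> V - {t}}"
      and S: "S1 \<subseteq> E \<inter> Pow A" "connected_graph A S1" "S2 \<subseteq> E \<inter> Pow (V - A)"
    have "uncut (S1 \<union> S2) A"
      unfolding uncut_Un using S by (intro conjI uncut_full[of S1 A] uncut_full[of S2 "V - A"]) auto
    then have nc: "\<not> connected_graph V (S1 \<union> S2)"
      using A st connected_graphD[of V "S1 \<union> S2" A s] by auto
    have "connected_graph V (insert {s, t} (S1 \<union> S2)) \<longleftrightarrow> connected_graph (V - A) S2"
    proof
      assume c: "connected_graph V (insert {s, t} (S1 \<union> S2))"
      have "V - A \<subseteq> U \<or> (V - A) \<inter> U = {}" if U: "uncut S2 U" for U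
      proof -
        \<comment> \<open>\<open>U\<close> is extended to \<open>V\<close> by placing
          \<open>A\<close>, which contains \<open>s\<close>, on the side of \<open>t\<close>; then
          the added edge is not cut.\<close>
        let ?U = "(U \<inter> (V - A)) \<union> (if t \<in> U then A else {})"
        have "U \<inter> (V - A) = ?U \<inter> (V - A)" by auto
        then have "uncut S2 ?U" using U S(3) uncut_cong[of S2 "V - A" U ?U] by simp
        moreover have "uncut S1 ?U" using S(1) by (intro uncut_full[of S1 A]) auto
        ultimately have "uncut (insert {s, t} (S1 \<union> S2)) ?U"
          using A st by (auto simp: uncut_insert uncut_Un)
        then have "V \<subseteq> ?U \<or> V \<inter> ?U = {}" using c by (simp add: connected_graph_iff)
        then show ?thesis by (auto split: if_splits)
      qed
      then show "connected_graph (V - A) S2" using A st by (auto simp: connected_graph_iff)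
    next
      assume c: "connected_graph (V - A) S2"
      show "connected_graph V (insert {s, t} (S1 \<union> S2))"
        unfolding connected_graph_iff
      proof (intro conjI allI impI)
        fix U assume "uncut (insert {s, t} (S1 \<union> S2)) U"
        then have "A \<subseteq> U \<or> A \<inter> U = {}" "V - A \<subseteq> U \<or> (V - A) \<inter> U = {}" "s \<in> U \<longleftrightarrow> t \<in> U"
          using c S(2) by (auto simp: uncut_insert uncut_Un connected_graph_iff)
        then show "V \<subseteq> U \<or> V \<inter> U = {}" using A st by blast
      qed (use st in auto)
    qed
    with nc show "?Q (S1 \<union> S2) \<longleftrightarrow> connected_graph (V - A) S2" by simp
  qed
  finally show ?thesis .
qed

text \<open>\<open>A\<close> is the component of \<open>s\<close> after deleting \<open>r\<close>.
  Being connected then amounts to three independent conditions: the edges inside \<open>A\<close>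
  connect \<open>A\<close>, some edge joins \<open>r\<close> to \<open>A\<close>, and the remaining
  edges connect \<open>V - A\<close>, which contains \<open>r\<close>. The second claim, the case of
  the full edge set, supplies the nonzero summand for the strict inequality in
  \<open>conn_gf_sign\<close>.\<close>

lemma conn_gf_remove_vertex:
  assumes G: "simple_graph V E" and rs: "r \<in> V" "s \<in> V" "r \<noteq> s"
  defines "N \<equiv> \<lambda>A. {e \<in> E. r \<in> e \<and> e - {r} \<subseteq> A}"
  defines "R \<equiv> \<lambda>A S. connected_graph V S \<and> uncut (S \<inter> Pow (V - {r})) A \<and> connected_graph A (S \<inter> Pow A)"
  shows "conn_gf V E w = (\<Sum>A | s \<in> A \<and> A \<subseteq> V - {r}.
      conn_gf A (E \<inter> Pow A) w * ((1 + w) ^ card (N A) - 1) * conn_gf (V - A) (E \<inter> Pow (V - A)) w)" (is ?th1)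
    and "connected_graph V E \<Longrightarrow> \<exists>A. s \<in> A \<and> A \<subseteq> V - {r} \<and> connected_graph A (E \<inter> Pow A)
      \<and> N A \<noteq> {} \<and> connected_graph (V - A) (E \<inter> Pow (V - A))" (is "_ \<Longrightarrow> ?th2")
proof -
  have fin: "finite V" "finite E" using simple_graph_finite[OF G] by auto
  let ?I = "{A. s \<in> A \<and> A \<subseteq> V - {r}}"
  have ex: "\<exists>A\<in>?I. R A S" if S: "S \<subseteq> E" "connected_graph V S" for S
  proof -
    obtain A where A: "s \<in> A" "A \<subseteq> V - {r}" "uncut (S \<inter> Pow (V - {r})) A"
        "connected_graph A (S \<inter> Pow (V - {r}) \<inter> Pow A)"
      using component_exists[of "S \<inter> Pow (V - {r})" "V - {r}" s] rs by auto
    moreover have "S \<inter> Pow (V - {r}) \<inter> Pow A = S \<inter> Pow A" using A(2) by auto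
    ultimately show ?thesis using S unfolding R_def by auto
  qed
  have disj: "(E \<inter> Pow A \<union> N A) \<inter> (E \<inter> Pow (V - A)) = {}" "E \<inter> Pow A \<inter> N A = {}"
    if A: "A \<in> ?I" for A
  proof -
    have "e \<notin> N A" if "e \<in> E" "e \<subseteq> V - A" for e
    proof
      assume "e \<in> N A"
      then have "e = {r}" using that by (auto simp: N_def)
      then show False using that G by (auto simp: simple_graph_def)
    qed
    then show "(E \<inter> Pow A \<union> N A) \<inter> (E \<inter> Pow (V - A)) = {}"
      using Pow_Compl_disjoint[OF G, of A] by auto
    show "E \<inter> Pow A \<inter> N A = {}" using A by (auto simp: N_def)
  qed
  have sub: "S \<subseteq> E \<inter> Pow A \<union> N A \<union> E \<inter> Pow (V - A)" if "S \<subseteq> E" "R A S" "A \<in> ?I" for A S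
  proof
    fix e assume e: "e \<in> S"
    then have "e \<in> E" using \<open>S \<subseteq> E\<close> by auto
    then obtain x y where xy: "e = {x, y}" "x \<noteq> y" "x \<in> V" "y \<in> V"
      by (rule simple_graph_edge[OF G])
    have "x = r \<or> y = r \<or> (x \<in> A \<longleftrightarrow> y \<in> A)"
      using uncutD[of "S \<inter> Pow (V - {r})" A x y] that xy e unfolding R_def by auto
    then show "e \<in> E \<inter> Pow A \<union> N A \<union> E \<inter> Pow (V - A)"
      using xy e that by (auto simp: N_def)
  qed
  \<comment> \<open>The three independent choices: \<open>S1\<close> inside \<open>A\<close>,
    \<open>N'\<close> between \<open>r\<close> and \<open>A\<close>, and \<open>S3\<close> inside
    \<open>V - A\<close>.\<close>
  have R: "R A (S1 \<union> N' \<union> S3) \<longleftrightarrow> (connected_graph A S1 \<and> N' \<noteq> {}) \<and> connected_graph (V - A) S3"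
    if A: "A \<in> ?I" and S: "S1 \<subseteq> E \<inter> Pow A" "N' \<subseteq> N A" "S3 \<subseteq> E \<inter> Pow (V - A)" for A S1 N' S3
  proof -
    let ?S = "S1 \<union> N' \<union> S3"
    have "N A \<inter> Pow A = {}" using A by (auto simp: N_def)
    then have SA: "?S \<inter> Pow A = S1"
      using S(1,2) Pow_Compl_Int_Pow[OF G S(3)] by auto
    have u1: "uncut S1 U" if "A \<subseteq> U \<or> A \<inter> U = {}" for U using S that by (intro uncut_full[of S1 A]) auto
    have u3: "uncut S3 U" if "V - A \<subseteq> U \<or> (V - A) \<inter> U = {}" for U
      using S that by (intro uncut_full[of S3 "V - A"]) auto
    have un: "uncut (?S \<inter> Pow (V - {r})) A"
    proof (rule uncut_subset)
      show "uncut (S1 \<union> S3) A" unfolding uncut_Un by (intro conjI u1 u3) auto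
      show "?S \<inter> Pow (V - {r}) \<subseteq> S1 \<union> S3" using S by (auto simp: N_def)
    qed
    have edge: "\<exists>a\<in>A. e = {r, a}" if "e \<in> N'" for e
    proof -
      have "e \<in> E" "r \<in> e" "e - {r} \<subseteq> A" using that S by (auto simp: N_def)
      moreover obtain x y where "e = {x, y}" "x \<noteq> y"
        using simple_graph_edge[OF G \<open>e \<in> E\<close>] by metis
      ultimately show ?thesis by (cases "x = r") auto
    qed
    have uN: "uncut N' U" if "A \<subseteq> U \<and> r \<in> U \<or> A \<inter> U = {} \<and> r \<notin> U" for U
      unfolding uncut_def
    proof (intro allI impI)
      fix x y assume "{x, y} \<in> N'"
      then obtain a where "a \<in> A" "{x, y} = {r, a}" using edge by blast
      then show "x \<in> U \<longleftrightarrow> y \<in> U" using that by (auto simp: doubleton_eq_iff)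
    qed
    have "connected_graph V ?S \<longleftrightarrow> N' \<noteq> {} \<and> connected_graph (V - A) S3" if c1: "connected_graph A S1"
    proof (intro iffI conjI)
      assume c: "connected_graph V ?S"
      show "N' \<noteq> {}"
      proof
        assume "N' = {}"
        then have "uncut ?S A" unfolding uncut_Un by (intro conjI u1 u3) (auto simp: uncut_def)
        then show False using c connected_graphD[of V ?S A s] A rs by auto
      qed
      have "V - A \<subseteq> U \<or> (V - A) \<inter> U = {}" if U: "uncut S3 U" for U
      proof -
        \<comment> \<open>\<open>A\<close> is placed on the side of \<open>r\<close>, so that no
          edge of \<open>N'\<close> is cut.\<close>
        let ?U = "(U \<inter> (V - A)) \<union> (if r \<in> U then A else {})"
        have "U \<inter> (V - A) = ?U \<inter> (V - A)" by auto
        then have "uncut S3 ?U" using U S(3) uncut_cong[of S3 "V - A" U ?U] by simp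
        moreover have "uncut S1 ?U" by (rule u1) auto
        moreover have "uncut N' ?U" by (rule uN) (use A rs in auto)
        ultimately have "uncut ?S ?U" by (simp add: uncut_Un)
        then have "V \<subseteq> ?U \<or> V \<inter> ?U = {}" using c by (simp add: connected_graph_iff)
        then show ?thesis by (auto split: if_splits)
      qed
      then show "connected_graph (V - A) S3" using A rs by (auto simp: connected_graph_iff)
    next
      assume c: "N' \<noteq> {} \<and> connected_graph (V - A) S3"
      then obtain a where a: "a \<in> A" "{r, a} \<in> N'" using edge by blast
      show "connected_graph V ?S"
        unfolding connected_graph_iff
      proof (intro conjI allI impI)
        fix U assume U: "uncut ?S U"
        then have "A \<subseteq> U \<or> A \<inter> U = {}" "V - A \<subseteq> U \<or> (V - A) \<inter> U = {}"
          using c c1 by (auto simp: uncut_Un connected_graph_iff)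
        moreover have "r \<in> U \<longleftrightarrow> a \<in> U" using U a by (auto simp: uncut_Un dest: uncutD)
        ultimately show "V \<subseteq> U \<or> V \<inter> U = {}" using A rs a by blast
      qed (use rs in auto)
    qed
    then show ?thesis unfolding R_def SA using un by auto
  qed
  have "conn_gf V E w = (\<Sum>A\<in>?I. subset_gf (R A) E w)"
  proof (rule subset_gf_sum)
    fix S A B assume AB: "A \<in> ?I" "B \<in> ?I" "R A S" "R B S"
    have eq: "S \<inter> Pow (V - {r}) \<inter> Pow C = S \<inter> Pow C" if "C \<in> ?I" for C using that by auto
    show "A = B"
      using component_unique[of s A "S \<inter> Pow (V - {r})" B] AB eq unfolding R_def by auto
  next
    show "\<exists>A\<in>?I. R A S" if "S \<subseteq> E" "connected_graph V S" for S using ex[OF that] .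
    show "connected_graph V S" if "R A S" for A S using that by (simp add: R_def)
  qed (use fin in auto)
  also have "\<dots> = (\<Sum>A\<in>?I. conn_gf A (E \<inter> Pow A) w * ((1 + w) ^ card (N A) - 1) * conn_gf (V - A) (E \<inter> Pow (V - A)) w)"
  proof (rule sum.cong[OF refl])
    fix A assume A: "A \<in> ?I"
    have finN: "finite (N A)" using fin by (auto simp: N_def)
    have "subset_gf (R A) E w = subset_gf (R A) (E \<inter> Pow A \<union> N A \<union> E \<inter> Pow (V - A)) w"
    proof (rule subset_gf_cong)
      fix S
      have "N A \<subseteq> E" by (auto simp: N_def)
      then show "S \<subseteq> E \<and> R A S \<longleftrightarrow> S \<subseteq> E \<inter> Pow A \<union> N A \<union> E \<inter> Pow (V - A) \<and> R A S"
        using sub[of S A] A by auto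
    qed
    \<comment> \<open>The product rule handles two factors at a time: first everything touching
      \<open>A\<close> is separated from the rest, then the edges inside \<open>A\<close> from those
      to \<open>r\<close>.\<close>
    also have "\<dots> = subset_gf (\<lambda>S. connected_graph A (S \<inter> Pow A) \<and> S \<inter> N A \<noteq> {}) (E \<inter> Pow A \<union> N A) w
        * conn_gf (V - A) (E \<inter> Pow (V - A)) w"
    proof (rule subset_gf_mult)
      fix S S3 assume S: "S \<subseteq> E \<inter> Pow A \<union> N A" "S3 \<subseteq> E \<inter> Pow (V - A)"
      have "S \<inter> Pow A \<union> S \<inter> N A = S" using S(1) by auto
      moreover have "S \<inter> Pow A \<subseteq> E \<inter> Pow A" using S A by (auto simp: N_def)
      ultimately show "R A (S \<union> S3) \<longleftrightarrow> (connected_graph A (S \<inter> Pow A) \<and> S \<inter> N A \<noteq> {}) \<and> connected_graph (V - A) S3"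
        using R[OF A, of "S \<inter> Pow A" "S \<inter> N A" S3] S by auto
    qed (use fin finN disj[OF A] in auto)
    also have "subset_gf (\<lambda>S. connected_graph A (S \<inter> Pow A) \<and> S \<inter> N A \<noteq> {}) (E \<inter> Pow A \<union> N A) w
       = conn_gf A (E \<inter> Pow A) w * subset_gf (\<lambda>S. S \<noteq> {}) (N A) w"
    proof (rule subset_gf_mult)
      fix S1 S2 assume S: "S1 \<subseteq> E \<inter> Pow A" "S2 \<subseteq> N A"
      have "N A \<inter> Pow A = {}" using A by (auto simp: N_def)
      then have "(S1 \<union> S2) \<inter> Pow A = S1" "(S1 \<union> S2) \<inter> N A = S2" using S by auto
      then show "connected_graph A ((S1 \<union> S2) \<inter> Pow A) \<and> (S1 \<union> S2) \<inter> N A \<noteq> {}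
          \<longleftrightarrow> connected_graph A S1 \<and> S2 \<noteq> {}" by simp
    qed (use fin finN disj[OF A] in auto)
    finally show "subset_gf (R A) E w = conn_gf A (E \<inter> Pow A) w * ((1 + w) ^ card (N A) - 1) * conn_gf (V - A) (E \<inter> Pow (V - A)) w"
      using finN by (simp add: subset_gf_nonempty)
  qed
  finally show ?th1 .
  assume c: "connected_graph V E"
  obtain A where A: "A \<in> ?I" "R A E" using ex[OF order.refl c] by blast
  have "N A \<subseteq> E" by (auto simp: N_def)
  then have "E = E \<inter> Pow A \<union> N A \<union> E \<inter> Pow (V - A)" using sub[OF order.refl A(2,1)] by auto
  then show ?th2 using R[OF A(1) order.refl order.refl order.refl] A by auto
qed

section \<open>Sign of the connected generating function for negative weights\<close>

text \<open>For these \<open>w\<close> the absolute value of \<open>1 + w\<close> is below 1, so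
  \<open>(1 + w) ^ d - 1\<close> is at most 0, and negative for \<open>d > 0\<close>. All summands
  of \<open>conn_gf_remove_vertex\<close> thus share one sign by induction. The weak inequality is
  asserted for disconnected graphs too, since the induced subgraphs may be such. The exponent
  \<open>card V + 1\<close> has the parity of \<open>card V - 1\<close> and avoids truncated
  subtraction.\<close>

lemma conn_gf_sign:
  fixes w :: real
  assumes w: "- 2 < w" "w < 0"
  shows "simple_graph V E \<Longrightarrow> 0 \<le> (- 1) ^ (card V + 1) * conn_gf V E w \<and>
    (connected_graph V E \<longrightarrow> 0 < (- 1) ^ (card V + 1) * conn_gf V E w)"
proof (induction "card V" arbitrary: V E rule: less_induct)
  case less
  note G = less.prems
  have fin: "finite V" "finite E" using simple_graph_finite[OF G] by auto
  consider "V = {}" | r where "V = {r}" | r s where "r \<in> V" "s \<in> V" "r \<noteq> s" by blast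
  then show ?case
  proof cases
    case 1
    then show ?thesis by (simp add: subset_gf_def connected_graph_def)
  next
    case 2
    have "e \<notin> E" for e using G 2 by (auto simp: simple_graph_def card_2_iff)
    then have "E = {}" by auto
    moreover have "connected_graph V {}" using 2 by (simp add: connected_graph_def)
    ultimately have "{S. S \<subseteq> E \<and> connected_graph V S} = {{}}" by auto
    then show ?thesis using 2 by (simp add: subset_gf_def)
  next
    case (3 r s)
    define N where "N A = {e \<in> E. r \<in> e \<and> e - {r} \<subseteq> A}" for A
    let ?I = "{A. s \<in> A \<and> A \<subseteq> V - {r}}"
    let ?f = "\<lambda>A. conn_gf A (E \<inter> Pow A) w * ((1 + w) ^ card (N A) - 1) * conn_gf (V - A) (E \<inter> Pow (V - A)) w"
    define h where "h B = (- 1) ^ (card B + 1) * conn_gf B (E \<inter> Pow B) w" for B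
    let ?g = "\<lambda>A. h A * (1 - (1 + w) ^ card (N A)) * h (V - A)"
    have sum: "conn_gf V E w = sum ?f ?I"
      unfolding N_def by (rule conn_gf_remove_vertex(1)[OF G 3])
    \<comment> \<open>Normalising both factors uses the exponents \<open>card A + 1\<close> and
      \<open>card (V - A) + 1\<close>, whose sum exceeds \<open>card V + 1\<close> by one. The
      leftover minus sign turns \<open>(1 + w) ^ n - 1\<close> into
      \<open>1 - (1 + w) ^ n\<close>.\<close>
    have fg: "(- 1) ^ (card V + 1) * ?f A = ?g A" if "A \<in> ?I" for A
    proof -
      have "card V = card A + card (V - A)"
        using that fin card_Diff_subset[of A V] card_mono[of V A] finite_subset[of A V] by force
      then show ?thesis by (simp add: h_def power_add algebra_simps)
    qed
    have IH: "0 \<le> h B \<and> (connected_graph B (E \<inter> Pow B) \<longrightarrow> 0 < h B)" if "B \<subset> V" for B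
      unfolding h_def using that fin by (intro less.hyps simple_graph_induced[OF G] psubset_card_mono) auto
    have abs1: "\<bar>1 + w\<bar> < 1" using w by linarith
    have le1: "(1 + w) ^ n \<le> 1" for n
      using power_le_one[of "\<bar>1 + w\<bar>" n] abs1 abs_ge_self[of "(1 + w) ^ n"] by (simp add: power_abs)
    have lt1: "(1 + w) ^ n < 1" if "n > 0" for n
      using power_less_one_iff[of "\<bar>1 + w\<bar>" n] abs1 that abs_ge_self[of "(1 + w) ^ n"] by (simp add: power_abs)
    have eq: "(- 1) ^ (card V + 1) * conn_gf V E w = sum ?g ?I"
      unfolding sum sum_distrib_left by (rule sum.cong[OF refl fg])
    have psub: "A \<subset> V" "V - A \<subset> V" if "A \<in> ?I" for A using that 3 by auto
    have ge: "0 \<le> ?g A" if "A \<in> ?I" for A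
      using IH[OF psub(1)[OF that]] IH[OF psub(2)[OF that]] le1 by (intro mult_nonneg_nonneg) auto
    have "0 < sum ?g ?I" if c: "connected_graph V E"
    proof -
      obtain A where A: "s \<in> A" "A \<subseteq> V - {r}" "connected_graph A (E \<inter> Pow A)"
         "N A \<noteq> {}" "connected_graph (V - A) (E \<inter> Pow (V - A))"
        using conn_gf_remove_vertex(2)[OF G 3 c] unfolding N_def by blast
      have "finite (N A)" using fin by (auto simp: N_def)
      then have "0 < ?g A"
        using IH[OF psub(1)[of A]] IH[OF psub(2)[of A]] A lt1[of "card (N A)"]
        by (intro mult_pos_pos) (auto simp: card_gt_0_iff)
      then show ?thesis using A ge fin by (intro sum_pos2[of ?I A]) auto
    qed
    then show ?thesis unfolding eq using ge by (auto intro: sum_nonneg)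
  qed
qed

subsection \<open>Two-terminal graphs\<close>

text \<open>For \<open>0 < x < 1\<close> the weight \<open>w = (1 - x) / x\<close> is positive and
  no cancellation is possible. For \<open>x > 1\<close> or \<open>x < -1\<close> it lies between -2
  and 0, where \<open>conn_gf_sign\<close> excludes a zero.\<close>

lemma real_root_range:
  assumes G: "simple_graph V E" "connected_graph V E" and root: "poly (rel_poly V E) (of_real x) = 0"
  shows "x \<in> {-1..0} \<union> {1}"
proof (rule ccontr)
  assume x: "x \<notin> {-1..0} \<union> {1}"
  then have x0: "x \<noteq> 0" by auto
  have fin: "finite E" using simple_graph_finite[OF G(1)] by auto
  define w where "w = (1 - x) / x"
  have "conn_gf V E (complex_of_real w) = 0"
    using root poly_rel_poly[OF fin, of "of_real x" V] x0 by (simp add: w_def)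
  then have 0: "conn_gf V E w = 0" by (simp add: subset_gf_of_real)
  show False
  proof (cases "w > 0")
    case True
    have "w ^ card E > 0" using True by simp
    then have "0 < conn_gf V E w"
      unfolding subset_gf_def using fin G True by (intro sum_pos2[of _ E]) auto
    then show False using 0 by simp
  next
    case False
    with x have "x > 1 \<or> x < - 1" by (auto simp: w_def zero_less_divide_iff)
    then have "- 2 < w" "w < 0" by (auto simp: w_def field_simps)
    then show False using conn_gf_sign[of w V E] G 0 by auto
  qed
qed

section \<open>Series and parallel composition\<close>

text \<open>For terminals in \<open>V\<close>, this says that \<open>S\<close> has exactly two
  components, one around each terminal. The virtual edge \<open>{s, t}\<close> avoids counting
  components.\<close>

abbreviation splits :: "'a set \<Rightarrow> 'a \<Rightarrow> 'a \<Rightarrow> 'a set set \<Rightarrow> bool" where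
  "splits V s t S \<equiv> connected_graph V (insert {s, t} S) \<and> \<not> connected_graph V S"

lemma connected_graph_mono: "connected_graph V S \<Longrightarrow> S \<subseteq> T \<Longrightarrow> connected_graph V T"
  unfolding connected_graph_iff by (meson uncut_subset)

text \<open>A cut witnessing disconnectedness disappears when \<open>{s, t}\<close> is added, so it
  separates \<open>s\<close> from \<open>t\<close>; passing to the complement if necessary puts
  \<open>s\<close> inside.\<close>

lemma splits_separated:
  assumes "splits V s t S"
  shows "\<exists>U. uncut S U \<and> s \<in> U \<and> t \<notin> U"
proof -
  have "V \<noteq> {}" using assms by (auto simp: connected_graph_iff)
  then obtain U where U: "uncut S U" "\<not> (V \<subseteq> U \<or> V \<inter> U = {})"
    using assms by (auto simp: connected_graph_iff)
  then have "\<not> (s \<in> U \<longleftrightarrow> t \<in> U)" using assms by (auto simp: connected_graph_iff uncut_insert)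
  then show ?thesis using U(1) uncut_Compl[of S U] by (metis ComplI ComplD)
qed

lemma connected_graph_uncut: "connected_graph V S \<Longrightarrow> uncut S U \<Longrightarrow> V \<subseteq> U \<or> V \<inter> U = {}"
  by (simp add: connected_graph_iff)

lemma uncut_empty: "uncut S {}"
  by (simp add: uncut_def)

text \<open>Cuts of the two parts glue as soon as they agree at both terminals. Hence each part must
  be connected up to a link between the terminals, and one part has to provide that link. In
  particular the union splits the terminals iff both parts do.\<close>

lemma connected_parallel:
  assumes V: "V1 \<inter> V2 = {s, t}" and S: "S1 \<subseteq> Pow V1" "S2 \<subseteq> Pow V2"
  shows "connected_graph (V1 \<union> V2) (insert {s, t} (S1 \<union> S2)) \<longleftrightarrow>
      connected_graph V1 (insert {s, t} S1) \<and> connected_graph V2 (insert {s, t} S2)" (is "?P \<longleftrightarrow> ?P1 \<and> ?P2")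
    and "connected_graph (V1 \<union> V2) (S1 \<union> S2) \<longleftrightarrow>
      connected_graph V1 (insert {s, t} S1) \<and> connected_graph V2 (insert {s, t} S2) \<and>
      (connected_graph V1 S1 \<or> connected_graph V2 S2)" (is "?C \<longleftrightarrow> _ \<and> _ \<and> (?C1 \<or> ?C2)")
proof -
  have st: "s \<in> V1" "s \<in> V2" "t \<in> V1" "t \<in> V2" using V by auto
  have glue: "uncut (S1 \<union> S2) (U1 \<inter> V1 \<union> U2 \<inter> V2)"
    if "uncut S1 U1" "uncut S2 U2" "s \<in> U1 \<longleftrightarrow> s \<in> U2" "t \<in> U1 \<longleftrightarrow> t \<in> U2" for U1 U2
  proof -
    have "U1 \<inter> V1 = (U1 \<inter> V1 \<union> U2 \<inter> V2) \<inter> V1" "U2 \<inter> V2 = (U1 \<inter> V1 \<union> U2 \<inter> V2) \<inter> V2"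
      using V that(3,4) by auto
    then show ?thesis
      using uncut_cong[OF S(1), of U1 "U1 \<inter> V1 \<union> U2 \<inter> V2"]
        uncut_cong[OF S(2), of U2 "U1 \<inter> V1 \<union> U2 \<inter> V2"] that by (simp add: uncut_Un)
  qed
  have full1: "uncut S1 V1" and full2: "uncut S2 V2" using S by (auto intro: uncut_full)
  have P1: ?P1 if ?P
    unfolding connected_graph_iff
  proof (intro conjI allI impI)
    fix U assume "uncut (insert {s, t} S1) U"
    then have U: "s \<in> U \<longleftrightarrow> t \<in> U" "uncut S1 U" by (auto simp: uncut_insert)
    \<comment> \<open>\<open>U\<close> contains both terminals or neither, so it extends to
      \<open>V2\<close> by a constant side.\<close>
    let ?U = "U \<inter> V1 \<union> (if s \<in> U then V2 else {}) \<inter> V2"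
    have "uncut S2 (if s \<in> U then V2 else {})" using full2 by (simp add: uncut_empty)
    then have "uncut (S1 \<union> S2) ?U" using U st by (intro glue) auto
    moreover have "s \<in> ?U \<longleftrightarrow> t \<in> ?U" using U st by auto
    ultimately have "uncut (insert {s, t} (S1 \<union> S2)) ?U" by (simp only: uncut_insert)
    then have "V1 \<union> V2 \<subseteq> ?U \<or> (V1 \<union> V2) \<inter> ?U = {}" using that by (simp add: connected_graph_iff)
    moreover have "?U \<inter> V1 = U \<inter> V1" using V U by auto
    ultimately show "V1 \<subseteq> U \<or> V1 \<inter> U = {}" by blast
  qed (use st in auto)
  have P2: ?P2 if ?P
    unfolding connected_graph_iff
  proof (intro conjI allI impI)
    fix U assume "uncut (insert {s, t} S2) U"
    then have U: "s \<in> U \<longleftrightarrow> t \<in> U" "uncut S2 U" by (auto simp: uncut_insert)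
    let ?U = "(if s \<in> U then V1 else {}) \<inter> V1 \<union> U \<inter> V2"
    have "uncut S1 (if s \<in> U then V1 else {})" using full1 by (simp add: uncut_empty)
    then have "uncut (S1 \<union> S2) ?U" using U st by (intro glue) auto
    moreover have "s \<in> ?U \<longleftrightarrow> t \<in> ?U" using U st by auto
    ultimately have "uncut (insert {s, t} (S1 \<union> S2)) ?U" by (simp only: uncut_insert)
    then have "V1 \<union> V2 \<subseteq> ?U \<or> (V1 \<union> V2) \<inter> ?U = {}" using that by (simp add: connected_graph_iff)
    moreover have "?U \<inter> V2 = U \<inter> V2" using V U by auto
    ultimately show "V2 \<subseteq> U \<or> V2 \<inter> U = {}" by blast
  qed (use st in auto)
  have join: "V1 \<union> V2 \<subseteq> U \<or> (V1 \<union> V2) \<inter> U = {}"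
    if "V1 \<subseteq> U \<or> V1 \<inter> U = {}" "V2 \<subseteq> U \<or> V2 \<inter> U = {}" for U
    using that st by blast
  show P: "?P \<longleftrightarrow> ?P1 \<and> ?P2"
  proof (intro iffI conjI)
    assume "?P1 \<and> ?P2"
    then show ?P
      using join st unfolding connected_graph_iff by (auto simp: uncut_insert uncut_Un)
  qed (use P1 P2 in auto)
  show "?C \<longleftrightarrow> ?P1 \<and> ?P2 \<and> (?C1 \<or> ?C2)"
  proof
    assume C: ?C
    then have p: ?P1 ?P2 using P connected_graph_mono by blast+
    have "?C1 \<or> ?C2"
    proof (rule ccontr)
      assume n: "\<not> (?C1 \<or> ?C2)"
      \<comment> \<open>Both cuts are chosen to contain \<open>s\<close> and omit \<open>t\<close>,
        so they agree at the terminals and glue to a cut of the union.\<close>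
      obtain U1 U2 where U: "uncut S1 U1" "s \<in> U1" "t \<notin> U1" "uncut S2 U2" "s \<in> U2" "t \<notin> U2"
        using splits_separated[of V1 s t S1] splits_separated[of V2 s t S2] n p by auto
      have "uncut (S1 \<union> S2) (U1 \<inter> V1 \<union> U2 \<inter> V2)" using U by (intro glue) auto
      then show False
        using connected_graphD[OF C, of "U1 \<inter> V1 \<union> U2 \<inter> V2" s] U st by auto
    qed
    with p show "?P1 \<and> ?P2 \<and> (?C1 \<or> ?C2)" by auto
  next
    assume A: "?P1 \<and> ?P2 \<and> (?C1 \<or> ?C2)"
    show ?C
      unfolding connected_graph_iff
    proof (intro conjI allI impI)
      fix U assume "uncut (S1 \<union> S2) U"
      then have U: "uncut S1 U" "uncut S2 U" by (auto simp: uncut_Un)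
      have "V1 \<subseteq> U \<or> V1 \<inter> U = {} \<or> V2 \<subseteq> U \<or> V2 \<inter> U = {}"
        using A U by (auto simp: connected_graph_iff)
      then have "s \<in> U \<longleftrightarrow> t \<in> U" using st by auto
      then have "uncut (insert {s, t} S1) U" "uncut (insert {s, t} S2) U"
        using U by (auto simp: uncut_insert)
      then show "V1 \<union> V2 \<subseteq> U \<or> (V1 \<union> V2) \<inter> U = {}"
        using A by (intro join) (auto simp: connected_graph_iff)
    qed (use st in auto)
  qed
qed

text \<open>Here cuts only have to agree at the single common vertex \<open>u\<close>. Adding the
  edge \<open>{s, t}\<close> closes a ring through \<open>u\<close>, which tolerates a split in at
  most one of the two parts.\<close>

lemma connected_series:
  assumes V: "V1 \<inter> V2 = {u}" "s \<in> V1" "t \<in> V2" and S: "S1 \<subseteq> Pow V1" "S2 \<subseteq> Pow V2"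
  shows "connected_graph (V1 \<union> V2) (S1 \<union> S2) \<longleftrightarrow> connected_graph V1 S1 \<and> connected_graph V2 S2"
      (is "?C \<longleftrightarrow> ?C1 \<and> ?C2")
    and "connected_graph (V1 \<union> V2) (insert {s, t} (S1 \<union> S2)) \<longleftrightarrow>
      connected_graph V1 (insert {s, u} S1) \<and> connected_graph V2 (insert {u, t} S2) \<and>
      (connected_graph V1 S1 \<or> connected_graph V2 S2)" (is "?P \<longleftrightarrow> ?P1 \<and> ?P2 \<and> (_ \<or> _)")
proof -
  have u: "u \<in> V1" "u \<in> V2" using V by auto
  have glue: "uncut (S1 \<union> S2) (U1 \<inter> V1 \<union> U2 \<inter> V2)"
    if "uncut S1 U1" "uncut S2 U2" "u \<in> U1 \<longleftrightarrow> u \<in> U2" for U1 U2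
  proof -
    have "U1 \<inter> V1 = (U1 \<inter> V1 \<union> U2 \<inter> V2) \<inter> V1" "U2 \<inter> V2 = (U1 \<inter> V1 \<union> U2 \<inter> V2) \<inter> V2"
      using V that(3) by auto
    then show ?thesis
      using uncut_cong[OF S(1), of U1 "U1 \<inter> V1 \<union> U2 \<inter> V2"]
        uncut_cong[OF S(2), of U2 "U1 \<inter> V1 \<union> U2 \<inter> V2"] that by (simp add: uncut_Un)
  qed
  have full1: "uncut S1 V1" and full2: "uncut S2 V2" using S by (auto intro: uncut_full)
  have join: "V1 \<union> V2 \<subseteq> U \<or> (V1 \<union> V2) \<inter> U = {}"
    if "V1 \<subseteq> U \<or> V1 \<inter> U = {}" "V2 \<subseteq> U \<or> V2 \<inter> U = {}" for U
    using that u by blast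
  \<comment> \<open>A cut of one part is extended to the other part by the constant side of
    \<open>u\<close>.\<close>
  let ?E1 = "\<lambda>U. U \<inter> V1 \<union> (if u \<in> U then V2 else {}) \<inter> V2"
  let ?E2 = "\<lambda>U. (if u \<in> U then V1 else {}) \<inter> V1 \<union> U \<inter> V2"
  have E1: "uncut (S1 \<union> S2) (?E1 U)" if "uncut S1 U" for U
    by (intro glue that) (use full2 u in \<open>auto simp: uncut_empty\<close>)
  have E2: "uncut (S1 \<union> S2) (?E2 U)" if "uncut S2 U" for U
    by (intro glue that) (use full1 u in \<open>auto simp: uncut_empty\<close>)
  have I1: "?E1 U \<inter> V1 = U \<inter> V1" for U using V u by auto
  have I2: "?E2 U \<inter> V2 = U \<inter> V2" for U using V u by auto
  show "?C \<longleftrightarrow> ?C1 \<and> ?C2"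
  proof (intro iffI conjI)
    assume C: ?C
    show ?C1 unfolding connected_graph_iff
    proof (intro conjI allI impI)
      fix U assume "uncut S1 U"
      then have "V1 \<union> V2 \<subseteq> ?E1 U \<or> (V1 \<union> V2) \<inter> ?E1 U = {}"
        using C E1 unfolding connected_graph_iff by blast
      then show "V1 \<subseteq> U \<or> V1 \<inter> U = {}" using I1[of U] by blast
    qed (use u in auto)
    show ?C2 unfolding connected_graph_iff
    proof (intro conjI allI impI)
      fix U assume "uncut S2 U"
      then have "V1 \<union> V2 \<subseteq> ?E2 U \<or> (V1 \<union> V2) \<inter> ?E2 U = {}"
        using C E2 unfolding connected_graph_iff by blast
      then show "V2 \<subseteq> U \<or> V2 \<inter> U = {}" using I2[of U] by blast
    qed (use u in auto)
  next
    assume "?C1 \<and> ?C2"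
    then show ?C using join u unfolding connected_graph_iff by (auto simp: uncut_Un)
  qed
  show "?P \<longleftrightarrow> ?P1 \<and> ?P2 \<and> (?C1 \<or> ?C2)"
  proof
    assume P: ?P
    have p1: ?P1 unfolding connected_graph_iff
    proof (intro conjI allI impI)
      fix U assume "uncut (insert {s, u} S1) U"
      then have U: "s \<in> U \<longleftrightarrow> u \<in> U" "uncut S1 U" by (auto simp: uncut_insert)
      have "s \<in> ?E1 U \<longleftrightarrow> t \<in> ?E1 U" using U V u I1[of U] by (cases "u \<in> U") auto
      with E1[OF U(2)] have "uncut (insert {s, t} (S1 \<union> S2)) (?E1 U)"
        by (simp only: uncut_insert)
      then have "V1 \<union> V2 \<subseteq> ?E1 U \<or> (V1 \<union> V2) \<inter> ?E1 U = {}"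
        by (rule connected_graph_uncut[OF P])
      then show "V1 \<subseteq> U \<or> V1 \<inter> U = {}" using I1[of U] by blast
    qed (use u in auto)
    have p2: ?P2 unfolding connected_graph_iff
    proof (intro conjI allI impI)
      fix U assume "uncut (insert {u, t} S2) U"
      then have U: "u \<in> U \<longleftrightarrow> t \<in> U" "uncut S2 U" by (auto simp: uncut_insert)
      have "s \<in> ?E2 U \<longleftrightarrow> t \<in> ?E2 U" using U V u I2[of U] by (cases "u \<in> U") auto
      with E2[OF U(2)] have "uncut (insert {s, t} (S1 \<union> S2)) (?E2 U)"
        by (simp only: uncut_insert)
      then have "V1 \<union> V2 \<subseteq> ?E2 U \<or> (V1 \<union> V2) \<inter> ?E2 U = {}"
        by (rule connected_graph_uncut[OF P])
      then show "V2 \<subseteq> U \<or> V2 \<inter> U = {}" using I2[of U] by blast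
    qed (use u in auto)
    have "?C1 \<or> ?C2"
    proof (rule ccontr)
      assume n: "\<not> (?C1 \<or> ?C2)"
      \<comment> \<open>The second cut is taken around \<open>t\<close> rather than
        \<open>u\<close>: the glued set then contains \<open>s\<close> and \<open>t\<close> but not
        \<open>u\<close>, and the added edge does not cross it.\<close>
      obtain U1 U2 where U: "uncut S1 U1" "s \<in> U1" "u \<notin> U1" "uncut S2 U2" "t \<in> U2" "u \<notin> U2"
        using splits_separated[of V1 s u S1] splits_separated[of V2 t u S2] n p1 p2
        by (auto simp: insert_commute)
      have "uncut (S1 \<union> S2) (U1 \<inter> V1 \<union> U2 \<inter> V2)" using U by (intro glue) auto
      then have "uncut (insert {s, t} (S1 \<union> S2)) (U1 \<inter> V1 \<union> U2 \<inter> V2)"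
        using U V by (simp add: uncut_insert)
      then show False
        using connected_graphD[OF P, of "U1 \<inter> V1 \<union> U2 \<inter> V2" s] U u V by auto
    qed
    with p1 p2 show "?P1 \<and> ?P2 \<and> (?C1 \<or> ?C2)" by auto
  next
    assume A: "?P1 \<and> ?P2 \<and> (?C1 \<or> ?C2)"
    show ?P
      unfolding connected_graph_iff
    proof (intro conjI allI impI)
      fix U assume "uncut (insert {s, t} (S1 \<union> S2)) U"
      then have U: "uncut S1 U" "uncut S2 U" "s \<in> U \<longleftrightarrow> t \<in> U" by (auto simp: uncut_Un uncut_insert)
      have "(V1 \<subseteq> U \<or> V1 \<inter> U = {}) \<or> (V2 \<subseteq> U \<or> V2 \<inter> U = {})"
        using A U by (auto simp: connected_graph_iff)
      then have "s \<in> U \<longleftrightarrow> u \<in> U" "u \<in> U \<longleftrightarrow> t \<in> U" using U u V by auto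
      then have "uncut (insert {s, u} S1) U" "uncut (insert {u, t} S2) U"
        using U by (auto simp: uncut_insert)
      then show "V1 \<union> V2 \<subseteq> U \<or> (V1 \<union> V2) \<inter> U = {}"
        using A by (intro join) (auto simp: connected_graph_iff)
    qed (use u in auto)
  qed
qed

lemma subset_gf_disj:
  assumes "finite E" "\<And>S. S \<subseteq> E \<Longrightarrow> \<not> (Q S \<and> Q' S)"
  shows "subset_gf (\<lambda>S. Q S \<or> Q' S) E w = subset_gf Q E w + subset_gf Q' E w"
proof -
  have "{S. S \<subseteq> E \<and> (Q S \<or> Q' S)} = {S. S \<subseteq> E \<and> Q S} \<union> {S. S \<subseteq> E \<and> Q' S}" by auto
  moreover have "finite {S. S \<subseteq> E \<and> Q S}" for Q
    by (rule finite_subset[of _ "Pow E"]) (use assms(1) in auto)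
  ultimately show ?thesis
    unfolding subset_gf_def using assms(2) by (subst sum.union_disjoint[symmetric]) auto
qed

text \<open>In the notation of weights this is \<open>c + d\<close>, the quantity that is
  multiplicative under parallel composition.\<close>

lemma conn_add_split_gf:
  assumes "finite E"
  shows "subset_gf (\<lambda>S. connected_graph V (insert {s, t} S)) E w =
    conn_gf V E w + subset_gf (splits V s t) E w"
proof -
  have "connected_graph V (insert {s, t} S) \<longleftrightarrow> connected_graph V S \<or> splits V s t S" for S
    using connected_graph_mono[of V S "insert {s, t} S"] by auto
  then show ?thesis using subset_gf_disj[OF assms, of "connected_graph V" "splits V s t" w] by simp
qed

text \<open>\<open>c\<close> and \<open>d\<close> are the weights of the edge sets that connect everything, respectively leave two
  components which separate the terminals. Quantifying over \<open>s\<close>, \<open>t\<close> and the set \<open>F\<close> of forbidden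
  vertices makes fresh copies available without renaming; \<open>adj\<close> records whether the terminals may
  be adjacent, which rules out parallel composition in simple graphs.\<close>

definition two_terminal :: "bool \<Rightarrow> complex \<Rightarrow> complex \<Rightarrow> complex \<Rightarrow> bool" where
  "two_terminal adj w c d \<longleftrightarrow> (\<forall>(s::nat) t F. s \<noteq> t \<longrightarrow> finite F \<longrightarrow>
    (\<exists>V E. simple_graph V E \<and> connected_graph V E \<and> s \<in> V \<and> t \<in> V \<and> V \<inter> F \<subseteq> {s, t} \<and>
       ({s, t} \<in> E \<longrightarrow> adj) \<and> conn_gf V E w = c \<and> subset_gf (splits V s t) E w = d))"

lemma two_terminalE:
  fixes s t :: nat
  assumes "two_terminal adj w c d" "s \<noteq> t" "finite F"
  obtains V E where "simple_graph V E" "connected_graph V E" "s \<in> V" "t \<in> V" "V \<inter> F \<subseteq> {s, t}"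
    "{s, t} \<in> E \<longrightarrow> adj" "conn_gf V E w = c" "subset_gf (splits V s t) E w = d"
  using assms(1)[unfolded two_terminal_def, rule_format, OF assms(2,3)] that by auto

text \<open>Both \<open>d\<close> and \<open>c + d\<close> multiply; the formula for
  \<open>c\<close> is the difference. Since the terminals are not adjacent in either part, the edge
  sets are disjoint.\<close>

lemma two_terminal_parallel:
  assumes "two_terminal False w c1 d1" "two_terminal False w c2 d2"
  shows "two_terminal False w (c1 * c2 + c1 * d2 + d1 * c2) (d1 * d2)"
  unfolding two_terminal_def
proof (intro allI impI)
  fix s t :: nat and F assume st: "s \<noteq> t" and F: "finite (F :: nat set)"
  obtain V1 E1 where 1: "simple_graph V1 E1" "connected_graph V1 E1" "s \<in> V1" "t \<in> V1" "V1 \<inter> F \<subseteq> {s, t}"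
      "{s, t} \<notin> E1" "conn_gf V1 E1 w = c1" "subset_gf (splits V1 s t) E1 w = d1"
    using two_terminalE[OF assms(1) st F] by auto
  have fin1: "finite V1" "finite E1" using simple_graph_finite[OF 1(1)] by auto
  obtain V2 E2 where 2: "simple_graph V2 E2" "connected_graph V2 E2" "s \<in> V2" "t \<in> V2" "V2 \<inter> (F \<union> V1) \<subseteq> {s, t}"
      "{s, t} \<notin> E2" "conn_gf V2 E2 w = c2" "subset_gf (splits V2 s t) E2 w = d2"
    using two_terminalE[OF assms(2) st finite_UnI[OF F fin1(1)]] by auto
  have fin2: "finite V2" "finite E2" using simple_graph_finite[OF 2(1)] by auto
  have V: "V1 \<inter> V2 = {s, t}" using 1 2 by auto
  have P: "E1 \<subseteq> Pow V1" "E2 \<subseteq> Pow V2" using 1(1) 2(1) by (auto dest: simple_graph_Pow)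
  have disj: "E1 \<inter> E2 = {}"
  proof -
    have False if e: "e \<in> E1" "e \<in> E2" for e
    proof -
      obtain x y where "e = {x, y}" "x \<noteq> y" by (rule simple_graph_edge[OF 1(1) e(1)])
      moreover have "e \<subseteq> {s, t}" using e P V by blast
      ultimately have "e = {s, t}" by auto
      then show False using e 1 by simp
    qed
    then show ?thesis by auto
  qed
  let ?V = "V1 \<union> V2" and ?E = "E1 \<union> E2"
  note con = connected_parallel[OF V order.trans[OF _ P(1)] order.trans[OF _ P(2)]]
  have G: "simple_graph ?V ?E" using 1 2 by (auto simp: simple_graph_def)
  have "connected_graph V1 (insert {s, t} E1)" "connected_graph V2 (insert {s, t} E2)"
    using 1(2) 2(2) connected_graph_mono by blast+
  then have C: "connected_graph ?V ?E" using con(2)[of E1 E2] 1(2) by blast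
  have d: "subset_gf (splits ?V s t) ?E w = d1 * d2"
    unfolding 1(8)[symmetric] 2(8)[symmetric]
    by (rule subset_gf_mult) (use fin1 fin2 disj con in auto)
  have "subset_gf (\<lambda>S. connected_graph ?V (insert {s, t} S)) ?E w =
      subset_gf (\<lambda>S. connected_graph V1 (insert {s, t} S)) E1 w *
      subset_gf (\<lambda>S. connected_graph V2 (insert {s, t} S)) E2 w"
    by (rule subset_gf_mult) (use fin1 fin2 disj con in auto)
  then have c: "conn_gf ?V ?E w = c1 * c2 + c1 * d2 + d1 * c2"
    using 1(7,8) 2(7,8) d fin1 fin2 by (simp add: conn_add_split_gf algebra_simps)
  show "\<exists>V E. simple_graph V E \<and> connected_graph V E \<and> s \<in> V \<and> t \<in> V \<and> V \<inter> F \<subseteq> {s, t} \<and>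
       ({s, t} \<in> E \<longrightarrow> False) \<and> conn_gf V E w = c1 * c2 + c1 * d2 + d1 * c2 \<and> subset_gf (splits V s t) E w = d1 * d2"
    by (intro exI[of _ ?V] exI[of _ ?E] conjI G C c d) (use 1 2 in auto)
qed

text \<open>\<open>c\<close> multiplies, and a splitting set splits exactly one of the parts and
  connects the other. The fresh middle vertex \<open>u\<close> makes the new terminals nonadjacent
  whatever the parts are, so the result may be used in parallel.\<close>

lemma two_terminal_series:
  assumes "two_terminal a1 w c1 d1" "two_terminal a2 w c2 d2"
  shows "two_terminal False w (c1 * c2) (c1 * d2 + d1 * c2)"
  unfolding two_terminal_def
proof (intro allI impI)
  fix s t :: nat and F assume st: "s \<noteq> t" and F: "finite (F :: nat set)"
  obtain u where u: "u \<notin> insert s (insert t F)"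
    using ex_new_if_finite[of "insert s (insert t F)"] F by auto
  have sut: "s \<noteq> u" "u \<noteq> t" "finite (insert t F)" using u F by auto
  obtain V1 E1 where 1: "simple_graph V1 E1" "connected_graph V1 E1" "s \<in> V1" "u \<in> V1" "V1 \<inter> insert t F \<subseteq> {s, u}"
      "{s, u} \<in> E1 \<longrightarrow> a1" "conn_gf V1 E1 w = c1" "subset_gf (splits V1 s u) E1 w = d1"
    \<comment> \<open>Declaring \<open>t\<close> forbidden keeps it out of the first part; otherwise
      the parts could meet in more than \<open>u\<close>.\<close>
    by (rule two_terminalE[OF assms(1) sut(1,3)])
  have fin1: "finite V1" "finite E1" using simple_graph_finite[OF 1(1)] by auto
  obtain V2 E2 where 2: "simple_graph V2 E2" "connected_graph V2 E2" "u \<in> V2" "t \<in> V2" "V2 \<inter> (F \<union> V1) \<subseteq> {u, t}"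
      "{u, t} \<in> E2 \<longrightarrow> a2" "conn_gf V2 E2 w = c2" "subset_gf (splits V2 u t) E2 w = d2"
    by (rule two_terminalE[OF assms(2) sut(2) finite_UnI[OF F fin1(1)]])
  have fin2: "finite V2" "finite E2" using simple_graph_finite[OF 2(1)] by auto
  have V: "V1 \<inter> V2 = {u}" using 1 2 st u by auto
  have P: "E1 \<subseteq> Pow V1" "E2 \<subseteq> Pow V2" using 1(1) 2(1) by (auto dest: simple_graph_Pow)
  have disj: "E1 \<inter> E2 = {}"
  proof -
    have False if e: "e \<in> E1" "e \<in> E2" for e
    proof -
      obtain x y where "e = {x, y}" "x \<noteq> y" by (rule simple_graph_edge[OF 1(1) e(1)])
      moreover have "e \<subseteq> {u}" using e P V by blast
      ultimately show False by auto
    qed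
    then show ?thesis by auto
  qed
  let ?V = "V1 \<union> V2" and ?E = "E1 \<union> E2"
  note con = connected_series[OF V 1(3) 2(4) order.trans[OF _ P(1)] order.trans[OF _ P(2)]]
  have mono: "connected_graph V1 S \<Longrightarrow> connected_graph V1 (insert {s, u} S)"
      "connected_graph V2 S \<Longrightarrow> connected_graph V2 (insert {u, t} S)" for S
    using connected_graph_mono by blast+
  have G: "simple_graph ?V ?E" using 1 2 by (auto simp: simple_graph_def)
  have C: "connected_graph ?V ?E" using con(1)[of E1 E2] 1(2) 2(2) by blast
  have c: "conn_gf ?V ?E w = c1 * c2"
    unfolding 1(7)[symmetric] 2(7)[symmetric]
    by (rule subset_gf_mult) (use fin1 fin2 disj con in auto)
  have fin: "finite ?E" using fin1 fin2 by auto
  have "subset_gf (splits ?V s t) ?E w =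
      subset_gf (\<lambda>S. (connected_graph V1 (S \<inter> E1) \<and> splits V2 u t (S \<inter> E2))
        \<or> (splits V1 s u (S \<inter> E1) \<and> connected_graph V2 (S \<inter> E2))) ?E w"
  proof (rule subset_gf_cong)
    fix S assume "S \<subseteq> ?E \<or> S \<subseteq> ?E"
    then have S: "S \<subseteq> ?E" "S = S \<inter> E1 \<union> S \<inter> E2" by auto
    have "splits ?V s t (S \<inter> E1 \<union> S \<inter> E2) \<longleftrightarrow>
       (connected_graph V1 (S \<inter> E1) \<and> splits V2 u t (S \<inter> E2))
        \<or> (splits V1 s u (S \<inter> E1) \<and> connected_graph V2 (S \<inter> E2))"
      using con[of "S \<inter> E1" "S \<inter> E2"] mono by auto
    with S show "S \<subseteq> ?E \<and> splits ?V s t S \<longleftrightarrow> S \<subseteq> ?E \<and>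
       ((connected_graph V1 (S \<inter> E1) \<and> splits V2 u t (S \<inter> E2))
        \<or> (splits V1 s u (S \<inter> E1) \<and> connected_graph V2 (S \<inter> E2)))" by metis
  qed
  also have "\<dots> = subset_gf (\<lambda>S. connected_graph V1 (S \<inter> E1) \<and> splits V2 u t (S \<inter> E2)) ?E w
        + subset_gf (\<lambda>S. splits V1 s u (S \<inter> E1) \<and> connected_graph V2 (S \<inter> E2)) ?E w"
    by (rule subset_gf_disj[OF fin]) auto
  also have "\<dots> = c1 * d2 + d1 * c2"
  proof -
    have I: "(S1 \<union> S2) \<inter> E1 = S1 \<and> (S1 \<union> S2) \<inter> E2 = S2" if "S1 \<subseteq> E1" "S2 \<subseteq> E2" for S1 S2
      using that disj by auto
    show ?thesis
      unfolding 1(7,8)[symmetric] 2(7,8)[symmetric]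
      by (intro arg_cong2[of _ _ _ _ "(+)"] subset_gf_mult fin1 fin2 disj) (use I in auto)
  qed
  finally have d: "subset_gf (splits ?V s t) ?E w = c1 * d2 + d1 * c2" .
  have "t \<notin> V1" "s \<notin> V2" using 1 2 st u by auto
  then have ne: "{s, t} \<notin> ?E" using P by auto
  show "\<exists>V E. simple_graph V E \<and> connected_graph V E \<and> s \<in> V \<and> t \<in> V \<and> V \<inter> F \<subseteq> {s, t} \<and>
       ({s, t} \<in> E \<longrightarrow> False) \<and> conn_gf V E w = c1 * c2 \<and> subset_gf (splits V s t) E w = c1 * d2 + d1 * c2"
    by (intro exI[of _ ?V] exI[of _ ?E] conjI G C c d) (use 1 2 u ne in auto)
qed

lemma two_terminal_edge: "two_terminal True w w 1"
  unfolding two_terminal_def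
proof (intro allI impI)
  fix s t :: nat and F assume st: "s \<noteq> t" and F: "finite (F :: nat set)"
  let ?V = "{s, t}" and ?E = "{{s, t}}"
  have C: "connected_graph ?V ?E" by (auto simp: connected_graph_iff uncut_insert)
  have "uncut {} {s}" by (simp add: uncut_def)
  then have N: "\<not> connected_graph ?V {}" using st by (auto simp: connected_graph_iff)
  have "{S. S \<subseteq> ?E \<and> connected_graph ?V S} = {?E}"
    using C N by (auto simp: subset_singleton_iff)
  then have c: "conn_gf ?V ?E w = w" by (simp add: subset_gf_def)
  have "{S. S \<subseteq> ?E \<and> splits ?V s t S} = {{}}"
    using C N by (auto simp: subset_singleton_iff)
  then have d: "subset_gf (splits ?V s t) ?E w = 1" unfolding subset_gf_def by simp
  have G: "simple_graph ?V ?E" using st by (auto simp: simple_graph_def)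
  show "\<exists>V E. simple_graph V E \<and> connected_graph V E \<and> s \<in> V \<and> t \<in> V \<and> V \<inter> F \<subseteq> {s, t} \<and>
       ({s, t} \<in> E \<longrightarrow> True) \<and> conn_gf V E w = w \<and> subset_gf (splits V s t) E w = 1"
    by (intro exI[of _ ?V] exI[of _ ?E] conjI G C c d) auto
qed

text \<open>The multiplicative pair is \<open>(c + d, d)\<close>, which explains the difference of
  powers.\<close>

lemma two_terminal_parallel_power:
  assumes "two_terminal False w c d" "k > 0"
  shows "two_terminal False w ((c + d) ^ k - d ^ k) (d ^ k)"
  using assms(2)
proof (induction k rule: nat_induct_non_zero)
  case 1
  then show ?case using assms(1) by simp
next
  case (Suc k)
  have "((c + d) ^ k - d ^ k) * c + ((c + d) ^ k - d ^ k) * d + d ^ k * c = (c + d) ^ Suc k - d ^ Suc k"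
    "d ^ k * d = d ^ Suc k" by (simp_all add: algebra_simps)
  then show ?case using two_terminal_parallel[OF Suc.IH assms(1)] by (simp only:)
qed

lemma two_terminal_series_power:
  assumes "two_terminal False w c d" "n > 0"
  shows "two_terminal False w (c ^ n) (of_nat n * c ^ (n - 1) * d)"
  using assms(2)
proof (induction n rule: nat_induct_non_zero)
  case 1
  then show ?case using assms(1) by simp
next
  case (Suc n)
  have "c ^ n * d + of_nat n * c ^ (n - 1) * d * c = of_nat (Suc n) * c ^ (Suc n - 1) * d"
    using Suc.hyps by (cases n) (simp_all add: algebra_simps)
  moreover have "c ^ n * c = c ^ Suc n" by simp
  ultimately show ?case using two_terminal_series[OF Suc.IH assms(1)] by (simp only:)
qed

text \<open>An edge in series with the gadget has weights \<open>w * c\<close> and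
  \<open>w * d + c\<close>. Bundling \<open>k\<close> copies gives weights \<open>C\<close> and
  \<open>D\<close> with \<open>C + D = (w * c + (w * d + c)) ^ k\<close>. A chain of
  \<open>N\<close> bundles closed by one more is a cycle, whose connected weight is
  \<open>C ^ N * (C + D + N * D)\<close>; the hypothesis is the vanishing of the last
  factor.\<close>

lemma Z_simple_of_two_terminal:
  assumes T: "two_terminal a ((1 - q) / q) c d" and q: "q \<noteq> 0" and kN: "k > 0" "N > 0"
    and zero: "((1 - q) / q * c + ((1 - q) / q * d + c)) ^ k + of_nat N * ((1 - q) / q * d + c) ^ k = 0"
  shows "q \<in> Z_simple"
proof -
  define w where "w = (1 - q) / q"
  define D where "D = (w * d + c) ^ k"
  define C where "C = (w * c + (w * d + c)) ^ k - D"
  have "two_terminal False w (w * c) (w * d + 1 * c)"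
    using two_terminal_series[OF two_terminal_edge] T unfolding w_def by blast
  then have "two_terminal False w C D"
    using two_terminal_parallel_power[of w "w * c" "w * d + c" k] kN by (simp add: C_def D_def)
  moreover from this have "two_terminal False w (C ^ N) (of_nat N * C ^ (N - 1) * D)"
    using kN by (intro two_terminal_series_power)
  \<comment> \<open>Putting the last bundle in parallel with the chain closes the cycle of
    \<open>N + 1\<close> bundles.\<close>
  ultimately have tt: "two_terminal False w (C ^ N * C + C ^ N * D + of_nat N * C ^ (N - 1) * D * C)
     (of_nat N * C ^ (N - 1) * D * D)"
    by (intro two_terminal_parallel)
  obtain V E where G: "simple_graph (V :: nat set) E" "connected_graph V E"
      "conn_gf V E w = C ^ N * C + C ^ N * D + of_nat N * C ^ (N - 1) * D * C"
    using two_terminalE[OF tt zero_neq_one finite.emptyI] by blast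
  have "C ^ N * C + C ^ N * D + of_nat N * C ^ (N - 1) * D * C = C ^ N * (C + D + of_nat N * D)"
    using kN by (cases N) (simp_all add: algebra_simps)
  also have "C + D + of_nat N * D = 0" using zero by (simp add: C_def D_def w_def)
  finally have "conn_gf V E w = 0" using G by simp
  then have "poly (rel_poly V E) q = 0"
    using poly_rel_poly[of E q V] q simple_graph_finite[OF G(1)] by (simp add: w_def)
  then show ?thesis using G unfolding Z_simple_def by blast
qed

subsection \<open>Cliques\<close>

definition complete_edges :: "'a set \<Rightarrow> 'a set set" where
  "complete_edges V = {e. e \<subseteq> V \<and> card e = 2}"

lemma simple_graph_complete: "finite V \<Longrightarrow> simple_graph V (complete_edges V)"
  by (auto simp: simple_graph_def complete_edges_def)

lemma card_complete_edges: "finite V \<Longrightarrow> card (complete_edges V) = card V choose 2"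
  by (simp add: complete_edges_def n_subsets)

lemma complete_edges_Int_Pow: "A \<subseteq> V \<Longrightarrow> complete_edges V \<inter> Pow A = complete_edges A"
  by (auto simp: complete_edges_def)

lemma connected_complete: "V \<noteq> {} \<Longrightarrow> connected_graph V (complete_edges V)"
  unfolding connected_graph_def
proof (intro conjI ballI)
  fix u v assume "u \<in> V" "v \<in> V"
  then show "(u, v) \<in> {(x, y). {x, y} \<in> complete_edges V}\<^sup>*"
    by (cases "u = v") (auto simp: complete_edges_def intro!: r_into_rtrancl)
qed

lemma connected_graph_image:
  assumes "connected_graph V S"
  shows "connected_graph (f ` V) ((`) f ` S)"
  unfolding connected_graph_iff
proof (intro conjI allI impI)
  show "f ` V \<noteq> {}" using assms by (simp add: connected_graph_def)
  fix U assume U: "uncut ((`) f ` S) U"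
  have "uncut S (f -` U)"
    unfolding uncut_def
  proof (intro allI impI)
    fix x y assume "{x, y} \<in> S"
    then have "f ` {x, y} \<in> (`) f ` S" by (rule imageI)
    then show "x \<in> f -` U \<longleftrightarrow> y \<in> f -` U" using uncutD[OF U, of "f x" "f y"] by simp
  qed
  then show "f ` V \<subseteq> U \<or> f ` V \<inter> U = {}" using connected_graph_uncut[OF assms] by blast
qed

lemma connected_graph_image_iff:
  assumes "inj_on f V" "S \<subseteq> Pow V"
  shows "connected_graph (f ` V) ((`) f ` S) \<longleftrightarrow> connected_graph V S"
proof
  let ?g = "inv_into V f"
  assume "connected_graph (f ` V) ((`) f ` S)"
  then have "connected_graph (?g ` f ` V) ((`) ?g ` (`) f ` S)" by (rule connected_graph_image)
  moreover have id: "?g ` f ` A = A" if "A \<subseteq> V" for A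
    using inv_into_image_cancel[OF assms(1) that] .
  have "(`) ?g ` (`) f ` S = (\<lambda>A. A) ` S"
    unfolding image_image[of "(`) ?g"] by (rule image_cong[OF refl]) (use id assms(2) in auto)
  ultimately show "connected_graph V S" using id[of V] by simp
qed (rule connected_graph_image)

lemma subset_gf_image:
  assumes "inj_on g E" "\<And>S. S \<subseteq> E \<Longrightarrow> Q' (g ` S) \<longleftrightarrow> Q S"
  shows "subset_gf Q' (g ` E) w = subset_gf Q E w"
  unfolding subset_gf_def
proof (rule sum.reindex_cong[of "(`) g"])
  show "inj_on ((`) g) {S. S \<subseteq> E \<and> Q S}"
    using assms(1) by (intro inj_onI) (auto simp: inj_on_image_eq_iff)
  show "{S. S \<subseteq> g ` E \<and> Q' S} = (`) g ` {S. S \<subseteq> E \<and> Q S}"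
    using assms(2) by (auto simp: subset_image_iff)
  fix S assume "S \<in> {S. S \<subseteq> E \<and> Q S}"
  then show "w ^ card (g ` S) = w ^ card S"
    using assms(1) by (auto simp: card_image inj_on_subset)
qed

lemma complete_edges_image:
  assumes "inj_on f V"
  shows "complete_edges (f ` V) = (`) f ` complete_edges V"
proof (intro equalityI subsetI)
  fix e assume "e \<in> complete_edges (f ` V)"
  then obtain e' where "e' \<subseteq> V" "e = f ` e'" "card e = 2"
    by (auto simp: complete_edges_def subset_image_iff)
  moreover from this have "card e' = 2"
    using card_image[OF inj_on_subset[OF assms, of e']] by simp
  ultimately show "e \<in> (`) f ` complete_edges V" by (auto simp: complete_edges_def)
next
  fix e assume "e \<in> (`) f ` complete_edges V"
  then obtain e' where "e' \<subseteq> V" "e = f ` e'" "card e' = 2"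
    by (auto simp: complete_edges_def)
  then show "e \<in> complete_edges (f ` V)"
    using card_image[OF inj_on_subset[OF assms, of e']] by (auto simp: complete_edges_def)
qed

definition clique_conn :: "nat \<Rightarrow> 'b::comm_ring_1 \<Rightarrow> 'b" where
  "clique_conn m w = conn_gf {..<m} (complete_edges {..<m}) w"

definition clique_split :: "nat \<Rightarrow> 'b::comm_ring_1 \<Rightarrow> 'b" where
  "clique_split m w = subset_gf (splits {..<m} 0 1) (complete_edges {..<m}) w"

text \<open>A bijection from \<open>{..<m}\<close> sends 0 and 1 to the prescribed terminals and the
  other vertices outside \<open>F\<close>; both generating functions are invariant under it.\<close>

lemma two_terminal_clique:
  assumes m: "m \<ge> 2"
  shows "two_terminal True w (clique_conn m w) (clique_split m w)"
  unfolding two_terminal_def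
proof (intro allI impI)
  fix s t :: nat and F assume st: "s \<noteq> t" and F: "finite (F :: nat set)"
  obtain W where W: "finite W" "card W = m - 2" "W \<subseteq> - (insert s (insert t F))"
    using infinite_arbitrarily_large[of "- (insert s (insert t F))" "m - 2"] F
    by (auto simp: finite_compl)
  obtain h where h: "bij_betw h {2..<m} W"
    using finite_same_card_bij[of "{2..<m}" W] W by auto
  define f where "f i = (if i = 0 then s else if i = 1 then t else h i)" for i :: nat
  let ?V = "insert s (insert t W)" and ?E = "complete_edges (insert s (insert t W))"
  have dom: "{..<m} = insert 0 (insert 1 {2..<m})" using m by auto
  have "f ` {2..<m} = h ` {2..<m}" by (intro image_cong) (auto simp: f_def)
  then have "f ` {2..<m} = W" using h by (simp add: bij_betw_def)
  moreover have f01: "f 0 = s" "f 1 = t" by (simp_all add: f_def)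
  ultimately have im: "f ` {..<m} = ?V" unfolding dom by (simp only: image_insert)
  have "card ?V = m" using W st m by (subst card_insert_disjoint; auto)+
  then have inj: "inj_on f {..<m}"
    using eq_card_imp_inj_on[of "{..<m}" f] im by simp
  let ?K = "complete_edges {..<m}"
  have E: "?E = (`) f ` ?K" using complete_edges_image[OF inj] im by simp
  have "?K \<subseteq> Pow {..<m}" by (auto simp: complete_edges_def)
  then have injE: "inj_on ((`) f) ?K"
    using inj_on_image_Pow[OF inj] inj_on_subset by blast
  have iff: "connected_graph ?V ((`) f ` S) \<longleftrightarrow> connected_graph {..<m} S" if "S \<subseteq> Pow {..<m}" for S
    using connected_graph_image_iff[OF inj that] im by simp
  have c: "conn_gf ?V ?E w = clique_conn m w"
    unfolding E clique_conn_def using \<open>?K \<subseteq> Pow {..<m}\<close>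
    by (intro subset_gf_image injE iff) auto
  have d: "subset_gf (splits ?V s t) ?E w = clique_split m w"
    unfolding E clique_split_def
  proof (rule subset_gf_image[OF injE])
    fix S assume "S \<subseteq> ?K"
    then have S: "S \<subseteq> Pow {..<m}" "insert {0, 1} S \<subseteq> Pow {..<m}"
      using \<open>?K \<subseteq> Pow {..<m}\<close> m by auto
    have "(`) f ` insert {0, 1} S = insert {s, t} ((`) f ` S)"
      by (simp only: image_insert image_empty f01)
    then show "splits ?V s t ((`) f ` S) \<longleftrightarrow> splits {..<m} 0 1 S"
      using iff[OF S(1)] iff[OF S(2)] by simp
  qed
  have G: "simple_graph ?V ?E" using W by (intro simple_graph_complete) auto
  have C: "connected_graph ?V ?E" by (intro connected_complete) auto
  show "\<exists>V E. simple_graph V E \<and> connected_graph V E \<and> s \<in> V \<and> t \<in> V \<and> V \<inter> F \<subseteq> {s, t} \<and>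
       ({s, t} \<in> E \<longrightarrow> True) \<and> conn_gf V E w = clique_conn m w \<and> subset_gf (splits V s t) E w = clique_split m w"
    by (intro exI[of _ ?V] exI[of _ ?E] conjI G C c d) (use W in auto)
qed

section \<open>Reliability of cliques inside the unit disk\<close>

text \<open>For finite \<open>V\<close> and \<open>q \<noteq> 0\<close> this is the value at
  \<open>q\<close> of the reliability polynomial of the complete graph on \<open>V\<close>.\<close>

definition clique_rel :: "'v set \<Rightarrow> 'b::field \<Rightarrow> 'b" where
  "clique_rel V q = q ^ (card V choose 2) * conn_gf V (complete_edges V) ((1 - q) / q)"

lemma choose_two_add: "(a + b) choose 2 = (a choose 2) + (b choose 2) + a * b"
  by (induction a) (simp_all add: numeral_2_eq_2 algebra_simps)

lemma choose_two_subset: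
  assumes "finite V" "A \<subseteq> V"
  shows "card V choose 2 = (card A choose 2) + (card (V - A) choose 2) + card A * card (V - A)"
proof -
  have "card V = card A + card (V - A)"
    using assms card_Diff_subset[of A V] card_mono[of V A] finite_subset[of A V] by force
  then show ?thesis by (simp add: choose_two_add)
qed

text \<open>For \<open>q\<close> between 0 and 1 this says that the probabilities of the possible
  components \<open>A\<close> of \<open>r\<close> sum to 1: \<open>A\<close> is connected and all
  \<open>card A * card (V - A)\<close> edges leaving it fail. Algebraically it is
  \<open>conn_gf_component_sum\<close> with \<open>1 + w = inverse q\<close>.\<close>

lemma clique_rel_sum:
  assumes V: "finite V" "r \<in> V" and q: "q \<noteq> 0"
  shows "(\<Sum>A | r \<in> A \<and> A \<subseteq> V. clique_rel A q * q ^ (card A * card (V - A))) = 1"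
proof -
  let ?w = "(1 - q) / q"
  have z: "1 + ?w = inverse q" using q by (simp add: field_simps)
  have "1 = q ^ (card V choose 2) * (1 + ?w) ^ card (complete_edges V)"
    using q V unfolding z by (simp add: card_complete_edges power_inverse)
  also have "\<dots> = q ^ (card V choose 2) * (\<Sum>A | r \<in> A \<and> A \<subseteq> V.
      conn_gf A (complete_edges V \<inter> Pow A) ?w * (1 + ?w) ^ card (complete_edges V \<inter> Pow (V - A)))"
    using conn_gf_component_sum[OF simple_graph_complete V(2), of ?w] V by simp
  also have "\<dots> = (\<Sum>A | r \<in> A \<and> A \<subseteq> V. clique_rel A q * q ^ (card A * card (V - A)))"
    unfolding sum_distrib_left
  proof (rule sum.cong[OF refl])
    fix A assume "A \<in> {A. r \<in> A \<and> A \<subseteq> V}"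
    then have A: "A \<subseteq> V" "V - A \<subseteq> V" by auto
    have "finite (V - A)" using V by auto
    then show "q ^ (card V choose 2) * (conn_gf A (complete_edges V \<inter> Pow A) ?w
       * (1 + ?w) ^ card (complete_edges V \<inter> Pow (V - A))) = clique_rel A q * q ^ (card A * card (V - A))"
      unfolding z complete_edges_Int_Pow[OF A(1)] complete_edges_Int_Pow[OF A(2)] clique_rel_def
        choose_two_subset[OF V(1) A(1)]
      using q by (simp add: card_complete_edges power_add power_inverse)
  qed
  finally show ?thesis by simp
qed

lemma clique_split_sum:
  assumes m: "m \<ge> 2"
  shows "q ^ (m choose 2) * clique_split m ((1 - q) / q) =
    (\<Sum>A | 0 \<in> A \<and> A \<subseteq> {..<m} - {1}.
      clique_rel A q * clique_rel ({..<m} - A) q * q ^ (card A * card ({..<m} - A)))"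
proof -
  let ?V = "{..<m}" and ?w = "(1 - q) / q"
  have "clique_split m ?w = (\<Sum>A | 0 \<in> A \<and> A \<subseteq> ?V - {1}.
      conn_gf A (complete_edges ?V \<inter> Pow A) ?w * conn_gf (?V - A) (complete_edges ?V \<inter> Pow (?V - A)) ?w)"
    unfolding clique_split_def using m by (intro split_gf_sum simple_graph_complete) auto
  moreover have "q ^ (m choose 2) * (conn_gf A (complete_edges ?V \<inter> Pow A) ?w
       * conn_gf (?V - A) (complete_edges ?V \<inter> Pow (?V - A)) ?w) =
       clique_rel A q * clique_rel (?V - A) q * q ^ (card A * card (?V - A))"
    if "A \<in> {A. 0 \<in> A \<and> A \<subseteq> ?V - {1}}" for A
  proof -
    have A: "A \<subseteq> ?V" "?V - A \<subseteq> ?V" using that by auto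
    show ?thesis
      unfolding complete_edges_Int_Pow[OF A(1)] complete_edges_Int_Pow[OF A(2)] clique_rel_def
      using choose_two_subset[OF finite_lessThan A(1)] by (simp add: power_add)
  qed
  ultimately show ?thesis by (simp add: sum_distrib_left)
qed

definition cut_bound :: "real \<Rightarrow> nat \<Rightarrow> real" where
  "cut_bound \<sigma> m = 2 * ((1 + \<sigma> ^ m) ^ m - 1)"

text \<open>With \<open>a = card A\<close>, \<open>b = card (V - A)\<close> and
  \<open>m = a + b\<close>, one has \<open>m * min a b \<le> 2 * a * b\<close>. So each term is at
  most \<open>t ^ a + t ^ b\<close> for \<open>t = \<sigma> ^ m\<close>, which is why the base is a
  square. Summing over subsets, each of the two families contributes at most
  \<open>(1 + t) ^ m - 1\<close>.\<close>

lemma cut_sum_le: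
  assumes \<sigma>: "0 < \<sigma>" "\<sigma> < 1" and V: "finite V"
    and I: "I \<subseteq> {A. A \<subseteq> V \<and> A \<noteq> {} \<and> A \<noteq> V}"
  shows "(\<Sum>A\<in>I. (\<sigma>\<^sup>2) ^ (card A * card (V - A))) \<le> cut_bound \<sigma> (card V)"
proof -
  define t where "t = \<sigma> ^ card V"
  have t: "0 \<le> t" "t \<le> 1" using \<sigma> by (auto simp: t_def power_le_one)
  let ?J = "{A. A \<subseteq> V \<and> A \<noteq> {}}" and ?J' = "{A. A \<subseteq> V \<and> A \<noteq> V}"
  have finJ: "finite ?J" "finite ?J'"
    by (rule finite_subset[of _ "Pow V"]; use V in auto)+
  have sub: "I \<subseteq> ?J" "I \<subseteq> ?J'" using I by auto
  have le: "(\<sigma>\<^sup>2) ^ (card A * card (V - A)) \<le> t ^ card A + t ^ card (V - A)" if "A \<in> I" for A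
  proof -
    have A: "A \<subseteq> V" using that I by auto
    let ?a = "card A" and ?b = "card (V - A)"
    have card: "card V = ?a + ?b"
      using A V card_Diff_subset[of A V] card_mono[of V A] finite_subset[of A V] by force
    have "(?a + ?b) * min ?a ?b \<le> 2 * (?a * ?b)"
    proof (cases "?a \<le> ?b")
      case True
      then show ?thesis using mult_right_mono[OF True, of ?a] by (simp add: algebra_simps)
    next
      case False
      then show ?thesis using mult_right_mono[of ?b ?a ?b] by (simp add: algebra_simps)
    qed
    then have "\<sigma> ^ (2 * (?a * ?b)) \<le> \<sigma> ^ ((?a + ?b) * min ?a ?b)"
      using \<sigma> by (intro power_decreasing) auto
    also have "\<dots> = t ^ min ?a ?b" by (simp add: t_def card power_mult)
    also have "\<dots> \<le> t ^ ?a + t ^ ?b" using t by (simp add: min_def)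
    finally show ?thesis by (simp add: power_mult)
  qed
  have 1: "(\<Sum>A\<in>?J. t ^ card A) = (1 + t) ^ card V - 1"
    using subset_gf_nonempty[OF V, of t] by (simp add: subset_gf_def)
  have "(\<Sum>A\<in>?J'. t ^ card (V - A)) = (\<Sum>A\<in>?J. t ^ card A)"
    by (rule sum.reindex_bij_witness[where i = "\<lambda>A. V - A" and j = "\<lambda>A. V - A"]) auto
  note 2 = this[unfolded 1]
  have "(\<Sum>A\<in>I. (\<sigma>\<^sup>2) ^ (card A * card (V - A))) \<le> (\<Sum>A\<in>I. t ^ card A + t ^ card (V - A))"
    by (rule sum_mono[OF le])
  also have "\<dots> = (\<Sum>A\<in>I. t ^ card A) + (\<Sum>A\<in>I. t ^ card (V - A))" by (simp add: sum.distrib)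
  also have "\<dots> \<le> (\<Sum>A\<in>?J. t ^ card A) + (\<Sum>A\<in>?J'. t ^ card (V - A))"
    using t by (intro add_mono sum_mono2 finJ sub) auto
  also have "\<dots> = cut_bound \<sigma> (card V)" unfolding 1 2 by (simp add: cut_bound_def t_def)
  finally show ?thesis .
qed

lemma cut_bound_nonneg: "0 < \<sigma> \<Longrightarrow> 0 \<le> cut_bound \<sigma> m"
  by (simp add: cut_bound_def)

lemma cut_bound_tendsto_0:
  assumes "0 < \<sigma>" "\<sigma> < 1"
  shows "cut_bound \<sigma> \<longlonglongrightarrow> 0"
proof -
  have "(\<lambda>m. real m * \<sigma> ^ m) \<longlonglongrightarrow> 0"
    using assms by (intro powser_times_n_limit_0) auto
  then have "(\<lambda>m. 2 * (exp (real m * \<sigma> ^ m) - 1)) \<longlonglongrightarrow> 2 * (exp 0 - 1)"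
    by (intro tendsto_intros)
  then have lim: "(\<lambda>m. 2 * (exp (real m * \<sigma> ^ m) - 1)) \<longlonglongrightarrow> 0" by simp
  show ?thesis
  proof (rule tendsto_sandwich[OF _ _ tendsto_const lim])
    show "\<forall>\<^sub>F m in sequentially. 0 \<le> cut_bound \<sigma> m" using cut_bound_nonneg assms by auto
    have "(1 + \<sigma> ^ m) ^ m \<le> exp (\<sigma> ^ m) ^ m" for m
      using assms by (intro power_mono exp_ge_add_one_self) auto
    then show "\<forall>\<^sub>F m in sequentially. cut_bound \<sigma> m \<le> 2 * (exp (real m * \<sigma> ^ m) - 1)"
      by (auto simp: cut_bound_def exp_of_nat_mult)
  qed
qed

text \<open>In \<open>clique_rel_sum\<close> the summand for \<open>A = V\<close> is
  \<open>clique_rel V q\<close> itself; all others carry a power of \<open>q\<close> indexed by a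
  proper cut, so the cut estimate applies.\<close>

lemma clique_rel_step:
  fixes q :: "'b::real_normed_field" and V :: "'v set"
  assumes \<sigma>: "0 < \<sigma>" "\<sigma> < 1" and q: "q \<noteq> 0" "norm q \<le> \<sigma>\<^sup>2" and V: "finite V" "V \<noteq> {}"
    and M: "M \<ge> 0" "\<And>A. A \<subset> V \<Longrightarrow> norm (clique_rel A q) \<le> M"
  shows "norm (clique_rel V q - 1) \<le> M * cut_bound \<sigma> (card V)"
proof -
  obtain r where r: "r \<in> V" using V by auto
  let ?I = "{A. r \<in> A \<and> A \<subseteq> V} - {V}"
  let ?f = "\<lambda>A. clique_rel A q * q ^ (card A * card (V - A))"
  have fin: "finite {A. r \<in> A \<and> A \<subseteq> V}" using V by auto
  have "1 = ?f V + sum ?f ?I"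
    unfolding clique_rel_sum[OF V(1) r q(1), symmetric] using r fin by (intro sum.remove) auto
  moreover have "a - 1 = - b" if "1 = a + b" for a b :: 'b by (subst that) simp
  ultimately have "clique_rel V q - 1 = - sum ?f ?I" by simp
  then have "norm (clique_rel V q - 1) = norm (sum ?f ?I)" by (simp only: norm_minus_cancel)
  also have "\<dots> \<le> (\<Sum>A\<in>?I. M * (\<sigma>\<^sup>2) ^ (card A * card (V - A)))"
  proof (rule sum_norm_le)
    fix A assume "A \<in> ?I"
    then have "norm (clique_rel A q) \<le> M" by (intro M(2)) auto
    moreover have "norm q ^ (card A * card (V - A)) \<le> (\<sigma>\<^sup>2) ^ (card A * card (V - A))"
      using q by (intro power_mono) auto
    ultimately show "norm (?f A) \<le> M * (\<sigma>\<^sup>2) ^ (card A * card (V - A))"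
      unfolding norm_mult norm_power by (intro mult_mono) (use M in auto)
  qed
  also have "\<dots> = M * (\<Sum>A\<in>?I. (\<sigma>\<^sup>2) ^ (card A * card (V - A)))" by (simp add: sum_distrib_left)
  also have "\<dots> \<le> M * cut_bound \<sigma> (card V)"
    using M by (intro mult_left_mono cut_sum_le \<sigma> V) auto
  finally show ?thesis .
qed

text \<open>Off the real interval from 0 to 1 the values are not probabilities, so a bound needs
  proof. For each size limit some bound exists by induction; once \<open>cut_bound\<close> is below
  1/2, any bound \<open>M \<ge> 2\<close> reproduces itself, as
  \<open>1 + M / 2 \<le> M\<close>.\<close>

lemma clique_rel_bounded:
  assumes \<sigma>: "0 < \<sigma>" "\<sigma> < 1"
  shows "\<exists>M\<ge>0. \<forall>(q :: 'b::real_normed_field) (V :: 'v set).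
    q \<noteq> 0 \<longrightarrow> norm q \<le> \<sigma>\<^sup>2 \<longrightarrow> finite V \<longrightarrow> norm (clique_rel V q) \<le> M"
proof -
  let ?P = "\<lambda>n M. \<forall>(q :: 'b) (V :: 'v set).
    q \<noteq> 0 \<longrightarrow> norm q \<le> \<sigma>\<^sup>2 \<longrightarrow> finite V \<longrightarrow> card V \<le> n \<longrightarrow> norm (clique_rel V q) \<le> M"
  have empty: "clique_rel ({} :: 'v set) (q :: 'b) = 0" for q
    by (simp add: clique_rel_def subset_gf_def connected_graph_def)
  have step: "norm (clique_rel V q) \<le> 1 + M * cut_bound \<sigma> (card V)"
    if "q \<noteq> 0" "norm q \<le> \<sigma>\<^sup>2" "finite V" "V \<noteq> {}" "M \<ge> 0" "\<And>A. A \<subset> V \<Longrightarrow> norm (clique_rel A q) \<le> M"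
    for M and q :: 'b and V :: "'v set"
    using clique_rel_step[OF \<sigma> that] norm_triangle_ineq2[of "clique_rel V q" 1] by simp
  obtain N where N: "\<And>m. m \<ge> N \<Longrightarrow> cut_bound \<sigma> m < 1 / 2"
    using order_tendstoD(2)[OF cut_bound_tendsto_0[OF \<sigma>], of "1/2"] by (auto simp: eventually_sequentially)
  have "\<exists>M\<ge>2. ?P n M" for n
  proof (induction n)
    case 0
    have "?P 0 2" using empty by auto
    then show ?case by (intro exI[of _ 2]) simp
  next
    case (Suc n)
    then obtain M where M: "M \<ge> 2" "?P n M" by blast
    let ?M = "max M (1 + M * cut_bound \<sigma> (Suc n))"
    have "norm (clique_rel V q) \<le> ?M"
      if q: "q \<noteq> 0" "norm q \<le> \<sigma>\<^sup>2" and V: "finite V" "card V \<le> Suc n" for q :: 'b and V :: "'v set"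
    proof (cases "card V \<le> n")
      case True
      then have "norm (clique_rel V q) \<le> M" using M(2) q V by blast
      then show ?thesis by simp
    next
      case False
      then have c: "card V = Suc n" using V by simp
      have "norm (clique_rel A q) \<le> M" if "A \<subset> V" for A
      proof -
        have "card A \<le> n" using psubset_card_mono[OF V(1) that] c by simp
        moreover have "finite A" using that V(1) finite_subset by blast
        ultimately show ?thesis using M(2) q by blast
      qed
      moreover have "V \<noteq> {}" using c by auto
      ultimately show ?thesis using step[OF q V(1), of M] M(1) c by simp
    qed
    then show ?case using M(1) by (intro exI[of _ ?M]) auto
  qed
  then obtain M where M: "M \<ge> 2" "?P N M" by blast
  have "norm (clique_rel V q) \<le> M" if q: "q \<noteq> 0" "norm q \<le> \<sigma>\<^sup>2" and "finite V" for q :: 'b and V :: "'v set"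
    using \<open>finite V\<close>
  proof (induction V rule: finite_psubset_induct)
    case (psubset V)
    show ?case
    proof (cases "card V \<le> N")
      case True
      then show ?thesis using M(2) q psubset.hyps by blast
    next
      case False
      then have "V \<noteq> {}" by auto
      then have "norm (clique_rel V q) \<le> 1 + M * cut_bound \<sigma> (card V)"
        using q psubset M by (intro step) auto
      also have "\<dots> \<le> 1 + M * (1 / 2)"
        using N[of "card V"] False M by (intro add_mono mult_left_mono) auto
      also have "\<dots> \<le> M" using M by simp
      finally show ?thesis .
    qed
  qed
  then show ?thesis using M(1) by (intro exI[of _ M]) auto
qed

text \<open>After scaling, the weights of a large clique approach \<open>(1, 0)\<close>, those of a
  single vertex. In the second limit every \<open>A\<close> contains 0 and omits 1, so only proper
  cuts occur and the cut estimate controls the whole sum.\<close>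

lemma clique_limits:
  assumes \<sigma>: "0 < \<sigma>" "\<sigma> < 1"
  defines "A \<equiv> {q :: 'b::real_normed_field. q \<noteq> 0 \<and> norm q \<le> \<sigma>\<^sup>2}"
  shows "uniform_limit A (\<lambda>m q. q ^ (m choose 2) * clique_conn m ((1 - q) / q)) (\<lambda>_. 1) sequentially"
    and "uniform_limit A (\<lambda>m q. q ^ (m choose 2) * clique_split m ((1 - q) / q)) (\<lambda>_. 0) sequentially"
proof -
  obtain M where M: "M \<ge> 0" "\<And>(q :: 'b) (V :: nat set). q \<noteq> 0 \<Longrightarrow> norm q \<le> \<sigma>\<^sup>2 \<Longrightarrow> finite V \<Longrightarrow> norm (clique_rel V q) \<le> M"
    using clique_rel_bounded[OF \<sigma>, where 'b = 'b and 'v = nat] by blast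
  have lim: "(\<lambda>m. C * cut_bound \<sigma> m) \<longlonglongrightarrow> 0" for C
    using tendsto_mult_right_zero[OF cut_bound_tendsto_0[OF \<sigma>]] by simp
  have rel: "q ^ (m choose 2) * clique_conn m ((1 - q) / q) = clique_rel {..<m} q" for m and q :: 'b
    by (simp add: clique_rel_def clique_conn_def)
  have unif: "uniform_limit A f (\<lambda>_. l) sequentially"
    if "\<And>m q. m \<ge> 2 \<Longrightarrow> q \<in> A \<Longrightarrow> norm (f m q - l) \<le> C * cut_bound \<sigma> m" for f :: "nat \<Rightarrow> 'b \<Rightarrow> 'b" and l C
  proof (rule uniform_limitI)
    fix e :: real assume "e > 0"
    then have "\<forall>\<^sub>F m in sequentially. C * cut_bound \<sigma> m < e" using order_tendstoD(2)[OF lim] by simp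
    then show "\<forall>\<^sub>F m in sequentially. \<forall>q\<in>A. dist (f m q) l < e"
      using eventually_ge_at_top[of 2]
    proof eventually_elim
      case (elim m)
      then show ?case using that[of m] by (force simp: dist_norm)
    qed
  qed
  show "uniform_limit A (\<lambda>m q. q ^ (m choose 2) * clique_conn m ((1 - q) / q)) (\<lambda>_. 1) sequentially"
    unfolding rel
  proof (rule unif[of _ _ M])
    fix m :: nat and q :: 'b assume "m \<ge> 2" and q: "q \<in> A"
    then have "{..<m} \<noteq> {}" by (auto simp: lessThan_empty_iff)
    then have "norm (clique_rel {..<m} q - 1) \<le> M * cut_bound \<sigma> (card {..<m})"
      using q M by (intro clique_rel_step \<sigma> M) (auto simp: A_def intro: finite_subset)
    then show "norm (clique_rel {..<m} q - 1) \<le> M * cut_bound \<sigma> m" by simp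
  qed
  show "uniform_limit A (\<lambda>m q. q ^ (m choose 2) * clique_split m ((1 - q) / q)) (\<lambda>_. 0) sequentially"
  proof (rule unif[of _ _ "M * M"])
    fix m :: nat and q :: 'b assume m: "m \<ge> 2" and q: "q \<in> A"
    then have q: "q \<noteq> 0" "norm q \<le> \<sigma>\<^sup>2" by (auto simp: A_def)
    let ?V = "{..<m}"
    let ?I = "{A. 0 \<in> A \<and> A \<subseteq> ?V - {1}}"
    have "norm (q ^ (m choose 2) * clique_split m ((1 - q) / q)) \<le>
       (\<Sum>A\<in>?I. M * M * (\<sigma>\<^sup>2) ^ (card A * card (?V - A)))"
      unfolding clique_split_sum[OF m]
    proof (rule sum_norm_le)
      fix A assume "A \<in> ?I"
      then have "finite A" by (auto intro: finite_subset)
      then have "norm (clique_rel A q) \<le> M" "norm (clique_rel (?V - A) q) \<le> M"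
        using M(2) q by auto
      moreover have "norm q ^ (card A * card (?V - A)) \<le> (\<sigma>\<^sup>2) ^ (card A * card (?V - A))"
        using q by (intro power_mono) auto
      ultimately show "norm (clique_rel A q * clique_rel (?V - A) q * q ^ (card A * card (?V - A)))
          \<le> M * M * (\<sigma>\<^sup>2) ^ (card A * card (?V - A))"
        unfolding norm_mult norm_power by (intro mult_mono) (use M in auto)
    qed
    also have "\<dots> = M * M * (\<Sum>A\<in>?I. (\<sigma>\<^sup>2) ^ (card A * card (?V - A)))" by (simp add: sum_distrib_left)
    also have "\<dots> \<le> M * M * cut_bound \<sigma> (card ?V)"
    proof (intro mult_left_mono cut_sum_le \<sigma>)
      have "1 \<in> ?V" using m by simp
      then show "?I \<subseteq> {A. A \<subseteq> ?V \<and> A \<noteq> {} \<and> A \<noteq> ?V}" by blast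
    qed (use M in auto)
    finally show "norm (q ^ (m choose 2) * clique_split m ((1 - q) / q) - 0) \<le> M * M * cut_bound \<sigma> m"
      by simp
  qed
qed

subsection \<open>Density of the roots\<close>

text \<open>The factor \<open>(c + d) ^ k + N * d ^ k\<close> of the cycle polynomial, for the edge-plus-clique gadget with
  weights \<open>c\<close>, \<open>d\<close>, scaled by a power of \<open>q\<close> that makes it converge to \<open>1 + N * q ^ k\<close>.\<close>

definition cycle_factor :: "nat \<Rightarrow> nat \<Rightarrow> nat \<Rightarrow> 'b::field \<Rightarrow> 'b" where
  "cycle_factor k N m q =
    (q ^ (m choose 2) * clique_conn m ((1 - q) / q) + (1 - q) * (q ^ (m choose 2) * clique_split m ((1 - q) / q))) ^ k
    + of_nat N * (q * (q ^ (m choose 2) * clique_conn m ((1 - q) / q))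
        + (1 - q) * (q ^ (m choose 2) * clique_split m ((1 - q) / q))) ^ k"

text \<open>An edge with its clique has \<open>Suc e\<close> edges, so the natural scaling is
  \<open>q ^ Suc e\<close>. The identities \<open>1 - q = q * w\<close> and
  \<open>q * (1 + w) = 1\<close> identify the scaled brackets with those of
  \<open>Z_simple_of_two_terminal\<close>.\<close>

lemma cycle_factor_root:
  assumes "q \<noteq> 0" "m \<ge> 2" "k > 0" "N > 0" and zero: "cycle_factor k N m q = 0"
  shows "q \<in> Z_simple"
proof -
  define w where "w = (1 - q) / q"
  define e where "e = m choose 2"
  define c where "c = clique_conn m w"
  define d where "d = clique_split m w"
  have qw: "1 - q = q * w" "q * (1 + w) = 1" using assms(1) by (simp_all add: w_def field_simps)
  have 1: "q ^ e * c + (1 - q) * (q ^ e * d) = q ^ Suc e * (w * c + (w * d + c))"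
  proof -
    have "q ^ Suc e * (w * c + (w * d + c)) = (q * (1 + w)) * q ^ e * c + q * w * (q ^ e * d)"
      by (simp add: algebra_simps)
    then show ?thesis using qw by simp
  qed
  have 2: "q * (q ^ e * c) + (1 - q) * (q ^ e * d) = q ^ Suc e * (w * d + c)"
    unfolding qw(1) by (simp add: algebra_simps)
  have "cycle_factor k N m q = (q ^ Suc e) ^ k * ((w * c + (w * d + c)) ^ k + of_nat N * (w * d + c) ^ k)"
    unfolding cycle_factor_def w_def[symmetric] c_def[symmetric] d_def[symmetric] e_def[symmetric] 1 2
      power_mult_distrib[of "q ^ Suc e"] by (simp only: algebra_simps)
  then have "(w * c + (w * d + c)) ^ k + of_nat N * (w * d + c) ^ k = 0"
    using zero assms(1) by simp
  then show ?thesis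
    using Z_simple_of_two_terminal[OF _ assms(1,3,4), of True c d] two_terminal_clique[OF assms(2), of w]
    unfolding w_def c_def d_def by blast
qed

lemma cycle_factor_of_real:
  "cycle_factor k N m (of_real x :: 'b::real_normed_field) = of_real (cycle_factor k N m x)"
proof -
  have "(1 - of_real x) / of_real x = (of_real ((1 - x) / x) :: 'b)" by simp
  then show ?thesis
    unfolding cycle_factor_def clique_conn_def clique_split_def by (simp only: subset_gf_of_real) simp
qed

text \<open>Products of uniform limits need bounded limit functions, so boundedness is carried along
  with the powers.\<close>

lemma uniform_limit_power_bounded:
  fixes f :: "'i \<Rightarrow> 'x \<Rightarrow> 'b::real_normed_field"
  assumes "uniform_limit A f g F" "bounded (g ` A)"
  shows "uniform_limit A (\<lambda>i x. f i x ^ k) (\<lambda>x. g x ^ k) F"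
proof -
  obtain B where B: "\<And>x. x \<in> A \<Longrightarrow> norm (g x) \<le> B" using assms(2) by (auto simp: bounded_iff)
  have "norm (g x ^ j) \<le> B ^ j" if "x \<in> A" for x j
    unfolding norm_power using B[OF that] by (intro power_mono) auto
  then have bnd: "bounded ((\<lambda>x. g x ^ j) ` A)" for j by (auto simp: bounded_iff)
  show ?thesis
  proof (induction k)
    case 0
    show ?case by (simp add: uniform_limit_const)
  next
    case (Suc k)
    have "uniform_limit A (\<lambda>i x. f i x * f i x ^ k) (\<lambda>x. g x * g x ^ k) F"
      by (intro uniform_lim_mult assms Suc bnd)
    then show ?case by simp
  qed
qed

lemma cycle_factor_limit:
  assumes \<sigma>: "0 < \<sigma>" "\<sigma> < 1"
  shows "uniform_limit {q :: 'b::real_normed_field. q \<noteq> 0 \<and> norm q \<le> \<sigma>\<^sup>2}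
    (cycle_factor k N) (\<lambda>q. 1 + of_nat N * q ^ k) sequentially"
proof -
  let ?A = "{q :: 'b. q \<noteq> 0 \<and> norm q \<le> \<sigma>\<^sup>2}"
  note lim = clique_limits[OF \<sigma>, where 'b = 'b]
  have b: "bounded ((\<lambda>q. q) ` ?A)" by (auto simp: bounded_iff)
  have bc: "bounded ((\<lambda>q. c) ` ?A)" for c :: 'b
    by (rule bounded_subset[of "{c}"]) auto
  have b1: "bounded ((\<lambda>q. 1 - q) ` ?A)"
    using bounded_minus_comp[OF bc b] by simp
  have "uniform_limit ?A (\<lambda>m q. (1 - q) * (q ^ (m choose 2) * clique_split m ((1 - q) / q)))
      (\<lambda>q. (1 - q) * 0) sequentially"
    by (intro uniform_lim_mult lim uniform_limit_const b1 bc)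
  then have d: "uniform_limit ?A (\<lambda>m q. (1 - q) * (q ^ (m choose 2) * clique_split m ((1 - q) / q)))
      (\<lambda>q. 0) sequentially" by simp
  have "uniform_limit ?A (\<lambda>m q. q * (q ^ (m choose 2) * clique_conn m ((1 - q) / q)))
      (\<lambda>q. q * 1) sequentially"
    by (intro uniform_lim_mult lim uniform_limit_const b bc)
  then have "uniform_limit ?A (\<lambda>m q. q * (q ^ (m choose 2) * clique_conn m ((1 - q) / q)))
      (\<lambda>q. q) sequentially" by simp
  from uniform_limit_add[OF this d] uniform_limit_add[OF lim(1) d]
  have 1: "uniform_limit ?A (\<lambda>m q. q ^ (m choose 2) * clique_conn m ((1 - q) / q)
      + (1 - q) * (q ^ (m choose 2) * clique_split m ((1 - q) / q))) (\<lambda>q. 1) sequentially"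
    and 2: "uniform_limit ?A (\<lambda>m q. q * (q ^ (m choose 2) * clique_conn m ((1 - q) / q))
      + (1 - q) * (q ^ (m choose 2) * clique_split m ((1 - q) / q))) (\<lambda>q. q) sequentially"
    by simp_all
  have bk: "bounded ((\<lambda>q. q ^ k) ` ?A)"
    unfolding bounded_iff by (rule exI[of _ "(\<sigma>\<^sup>2) ^ k"]) (auto simp: norm_power intro!: power_mono)
  note p1 = uniform_limit_power_bounded[OF 1 bc, of k] and p2 = uniform_limit_power_bounded[OF 2 b, of k]
  have "uniform_limit ?A (\<lambda>m q. of_nat N * (q * (q ^ (m choose 2) * clique_conn m ((1 - q) / q))
      + (1 - q) * (q ^ (m choose 2) * clique_split m ((1 - q) / q))) ^ k) (\<lambda>q. of_nat N * q ^ k) sequentially"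
    by (intro uniform_lim_mult uniform_limit_const bc p2 bk)
  from uniform_limit_add[OF p1 this] show ?thesis
    unfolding cycle_factor_def by simp
qed

lemma cycle_factor_holomorphic:
  assumes "0 \<notin> S"
  shows "cycle_factor k N m holomorphic_on S"
  unfolding cycle_factor_def clique_conn_def clique_split_def subset_gf_def
  using assms by (intro holomorphic_intros) auto

lemma cycle_factor_continuous:
  fixes S :: "real set"
  assumes "0 \<notin> S"
  shows "continuous_on S (cycle_factor k N m)"
  unfolding cycle_factor_def clique_conn_def clique_split_def subset_gf_def
  using assms by (intro continuous_intros) auto

section \<open>Roots of the model factor and of nearby graphs\<close>

text \<open>For large \<open>k\<close>, rounding \<open>1 / norm q0 ^ k\<close> up to
  \<open>N\<close> makes \<open>N * q0 ^ k\<close> of modulus between 1 and 2. The factor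
  \<open>u\<close> that corrects it to -1 has a logarithm bounded independently of \<open>k\<close>,
  so its \<open>k\<close>-th root \<open>exp (Ln u / k)\<close> is close to 1. As
  \<open>norm u \<le> 1\<close>, the corrected point stays in the disk. Odd \<open>k\<close> is
  demanded for the real case.\<close>

lemma dense_model_roots:
  fixes q0 :: complex
  assumes q0: "q0 \<noteq> 0" "norm q0 < 1" and e: "e > 0"
  obtains k N q1 where "odd k" "N > 0" "of_nat N * q1 ^ k = - 1" "norm q1 < 1" "dist q1 q0 < e"
proof -
  \<comment> \<open>\<open>C\<close> bounds \<open>norm (Ln u)\<close>: the real part lies between
    \<open>- ln 2\<close> and 0, the imaginary part between \<open>- pi\<close> and
    \<open>pi\<close>.\<close>
  define C where "C = ln 2 + pi"
  have C: "C > 0" unfolding C_def by (intro add_pos_pos) auto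
  have "isCont exp (0 :: complex)" by simp
  then obtain \<delta> where \<delta>: "\<delta> > 0" "\<And>z :: complex. norm z < \<delta> \<Longrightarrow> norm (exp z - 1) < e"
    using e unfolding continuous_at_eps_delta by (auto simp: dist_norm)
  obtain j :: nat where j: "C / \<delta> < real j" using reals_Archimedean2 by blast
  define k where "k = 2 * j + 1"
  have k: "odd k" "k > 0" "C / real k < \<delta>"
  proof -
    have "C < \<delta> * real j" using j \<delta>(1) by (simp add: field_simps)
    also have "\<dots> \<le> \<delta> * real k" using \<delta>(1) by (intro mult_left_mono) (auto simp: k_def)
    finally have "C < \<delta> * real k" .
    then show "C / real k < \<delta>" by (simp add: field_simps k_def)
  qed (auto simp: k_def)
  define x where "x = 1 / norm q0 ^ k"
  have x1: "x \<ge> 1" using q0 power_le_one[of "norm q0" k] by (simp add: x_def)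
  define N where "N = nat \<lceil>x\<rceil>"
  have N: "x \<le> real N" "real N \<le> 2 * x" "N > 0"
    using x1 by (simp_all add: N_def) linarith+
  define u where "u = - 1 / (of_nat N * q0 ^ k)"
  have u0: "u \<noteq> 0" using q0 N by (simp add: u_def)
  have nu: "norm u = x / real N" by (simp add: u_def x_def norm_divide norm_mult norm_power)
  have u: "1 / 2 \<le> norm u" "norm u \<le> 1" using N x1 by (simp_all add: nu field_simps)
  have lnu: "- ln 2 \<le> ln (norm u)" "ln (norm u) \<le> 0"
    using u u0 ln_mono[of "1/2" "norm u"] by (simp_all add: ln_div)
  have "norm (Ln u) \<le> \<bar>Re (Ln u)\<bar> + \<bar>Im (Ln u)\<bar>" by (rule cmod_le)
  also have "\<dots> \<le> C"
    using lnu u0 mpi_less_Im_Ln[OF u0] Im_Ln_le_pi[OF u0] by (simp add: C_def)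
  finally have Lnu: "norm (Ln u) \<le> C" .
  define z where "z = Ln u / of_nat k"
  have "norm z \<le> C / real k" using Lnu k by (simp add: z_def norm_divide divide_right_mono)
  then have z: "norm (exp z - 1) < e" using \<delta>(2) k(3) by simp
  define q1 where "q1 = q0 * exp z"
  show ?thesis
  proof (rule that[of k N q1])
    have "exp z ^ k = exp (of_nat k * z)" by (simp add: exp_of_nat_mult)
    also have "\<dots> = u" using k u0 by (simp add: z_def)
    finally show "of_nat N * q1 ^ k = - 1"
      using q0 N by (simp add: q1_def power_mult_distrib u_def)
    have "norm (exp z) \<le> 1" using lnu(2) u0 k by (simp add: z_def divide_le_0_iff)
    then have "norm q1 \<le> norm q0 * 1" unfolding q1_def norm_mult by (intro mult_left_mono) auto
    then show "norm q1 < 1" using q0 by simp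
    have "dist q1 q0 = norm (q0 * (exp z - 1))" by (simp add: q1_def dist_norm algebra_simps)
    also have "\<dots> \<le> 1 * norm (exp z - 1)" unfolding norm_mult using q0 by (intro mult_right_mono) auto
    finally show "dist q1 q0 < e" using z by simp
  qed (use k N in auto)
qed

text \<open>If no root were within \<open>e\<close>, the cycle factors would be zero-free on a small
  ball around \<open>q1\<close>, and by Hurwitz so would their nonconstant limit, which vanishes at
  \<open>q1\<close>.\<close>

lemma complex_root_near:
  fixes q1 :: complex
  assumes kN: "k > 0" "N > 0" and q1: "of_nat N * q1 ^ k = - 1" "norm q1 < 1" and e: "e > 0"
  shows "\<exists>q\<in>Z_simple. dist q q1 < e"
proof (rule ccontr)
  assume no: "\<not> ?thesis"
  have q10: "q1 \<noteq> 0" using q1 kN by (auto simp: zero_power)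
  define h where "h = (1 - norm q1) / 2"
  have h: "h > 0" "norm q1 + h = (1 + norm q1) / 2" using q1 by (simp_all add: h_def field_simps)
  \<comment> \<open>The ball must lie within distance \<open>e\<close>, avoid 0, where
    \<open>(1 - q) / q\<close> is singular, and stay in a disk of radius below 1.\<close>
  define \<delta> where "\<delta> = min e (min (norm q1) h)"
  have "0 < \<delta>" "\<delta> \<le> e" "\<delta> \<le> norm q1" "\<delta> \<le> h"
    using e h q10 by (simp_all add: \<delta>_def)
  then have \<delta>: "0 < \<delta>" "\<delta> \<le> e" "\<delta> \<le> norm q1" "norm q1 + \<delta> \<le> (1 + norm q1) / 2"
    using h by simp_all
  define \<sigma> where "\<sigma> = sqrt ((1 + norm q1) / 2)"
  have \<sigma>: "0 < \<sigma>" "\<sigma> < 1" "\<sigma>\<^sup>2 = (1 + norm q1) / 2"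
    using q1 by (simp_all add: \<sigma>_def add_pos_nonneg)
  have sub: "ball q1 \<delta> \<subseteq> {q. q \<noteq> 0 \<and> norm q \<le> \<sigma>\<^sup>2}"
  proof
    fix q assume "q \<in> ball q1 \<delta>"
    then have d: "norm (q1 - q) < \<delta>" by (simp add: dist_norm)
    then have "norm q \<le> \<sigma>\<^sup>2" using norm_triangle_ineq2[of q q1] \<delta> \<sigma> by (simp add: norm_minus_commute)
    moreover have "q \<noteq> 0" using d \<delta> by auto
    ultimately show "q \<in> {q. q \<noteq> 0 \<and> norm q \<le> \<sigma>\<^sup>2}" by simp
  qed
  let ?g = "\<lambda>q :: complex. 1 + of_nat N * q ^ k"
  \<comment> \<open>The shift by 2 gives every clique its two terminals.\<close>
  let ?F = "\<lambda>m. cycle_factor k N (m + 2) :: complex \<Rightarrow> complex"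
  have "uniform_limit {q. q \<noteq> 0 \<and> norm q \<le> \<sigma>\<^sup>2} (cycle_factor k N) ?g sequentially"
    by (rule cycle_factor_limit[OF \<sigma>(1,2)])
  then have ul: "uniform_limit {q. q \<noteq> 0 \<and> norm q \<le> \<sigma>\<^sup>2} ?F ?g sequentially"
    by (rule filterlim_compose[OF _ filterlim_add_const_nat_at_top])
  have "?g q1 \<noteq> 0"
  proof (rule Hurwitz_no_zeros[of "ball q1 \<delta>" ?F ?g])
    show "\<And>n. ?F n holomorphic_on ball q1 \<delta>" using \<delta> by (intro cycle_factor_holomorphic) auto
    show "?g holomorphic_on ball q1 \<delta>" by (intro holomorphic_intros)
    show "uniform_limit K ?F ?g sequentially" if "compact K" "K \<subseteq> ball q1 \<delta>" for K
      using uniform_limit_on_subset[OF ul] that sub by blast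
    show "\<not> ?g constant_on ball q1 \<delta>"
    proof
      assume "?g constant_on ball q1 \<delta>"
      then obtain c where c: "\<And>q. q \<in> ball q1 \<delta> \<Longrightarrow> ?g q = c" by (auto simp: constant_on_def)
      \<comment> \<open>Shrinking \<open>q1\<close> radially by the factor \<open>1 - t\<close>
        stays in the ball but changes the value of \<open>?g\<close>.\<close>
      define t where "t = \<delta> / 2"
      have t: "0 < t" "t < \<delta>" "t < 1" using \<delta> q1 by (auto simp: t_def)
      have "dist q1 (q1 * of_real (1 - t)) = norm q1 * t"
        using t by (simp add: dist_norm norm_mult algebra_simps)
      also have "\<dots> \<le> 1 * t" using t q1 by (intro mult_right_mono) auto
      finally have "q1 * of_real (1 - t) \<in> ball q1 \<delta>" using t by simp
      then have "?g (q1 * of_real (1 - t)) = ?g q1" using c[of q1] c \<delta> by simp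
      then have "of_real ((1 - t) ^ k) = (1 :: complex)"
        using q10 kN by (simp add: power_mult_distrib)
      then have "(1 - t) ^ k = 1" using of_real_eq_1_iff by blast
      moreover have "(1 - t) ^ k < 1" using t kN by (simp add: power_less_one_iff)
      ultimately show False by simp
    qed
    show "?F n z \<noteq> 0" if "z \<in> ball q1 \<delta>" for n z
    proof
      assume "?F n z = 0"
      then have "z \<in> Z_simple" using that \<delta> kN by (intro cycle_factor_root[of z "n + 2" k N]) auto
      then show False using no that \<delta> by (auto simp: dist_commute)
    qed
  qed (use \<delta> in auto)
  then show False using q1 by simp
qed

text \<open>For odd \<open>k\<close> the limit \<open>1 + N * y ^ k\<close> is strictly increasing,
  so it changes sign at \<open>x\<close>. The cycle factors inherit the sign change for large
  \<open>m\<close>, and the intermediate value theorem applies.\<close>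

lemma real_root_near:
  fixes x :: real
  assumes k: "odd k" and N: "N > 0" and x: "real N * x ^ k = - 1" "\<bar>x\<bar> < 1" and e: "e > 0"
  shows "\<exists>y. complex_of_real y \<in> Z_simple \<and> \<bar>y - x\<bar> < e"
proof -
  have k0: "k > 0" using k by (rule odd_pos)
  have x0: "x < 0"
  proof (rule ccontr)
    assume "\<not> x < 0"
    then have "real N * x ^ k \<ge> 0" by simp
    then show False using x by simp
  qed
  define \<delta> where "\<delta> = min (e / 2) (min (- x / 2) ((1 + x) / 2))"
  have \<delta>: "0 < \<delta>" "\<delta> < e" "x + \<delta> < 0" "- 1 < x - \<delta>"
    using e x x0 by (auto simp: \<delta>_def min_def field_simps)
  \<comment> \<open>\<open>\<sigma>\<^sup>2\<close> is the largest absolute value on the interval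
    from \<open>x - \<delta>\<close> to \<open>x + \<delta>\<close>, which lies in the negative
    reals.\<close>
  define \<sigma> where "\<sigma> = sqrt (- (x - \<delta>))"
  have \<sigma>: "0 < \<sigma>" "\<sigma> < 1" "\<sigma>\<^sup>2 = - (x - \<delta>)"
    using \<delta> x0 by (auto simp: \<sigma>_def)
  let ?g = "\<lambda>y :: real. 1 + real N * y ^ k"
  have lim: "(\<lambda>m. cycle_factor k N m y) \<longlonglongrightarrow> ?g y" if "x - \<delta> \<le> y" "y \<le> x + \<delta>" for y
    using tendsto_uniform_limitI[OF cycle_factor_limit[OF \<sigma>(1,2), of k N], of y] that \<sigma> \<delta> x0 by auto
  have mono: "a ^ k < b ^ k" if "a < b" for a b :: real
  proof -
    have "a ^ k \<noteq> b ^ k" using that odd_real_root_power_cancel[OF k] by (metis less_irrefl)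
    moreover have "a ^ k \<le> b ^ k" using that by (intro power_mono_odd k) auto
    ultimately show ?thesis by simp
  qed
  have "?g (x - \<delta>) < ?g x" "?g x < ?g (x + \<delta>)" using mono N \<delta> by simp_all
  then have neg: "?g (x - \<delta>) < 0" and pos: "?g (x + \<delta>) > 0" using x by simp_all
  have "\<forall>\<^sub>F m in sequentially. cycle_factor k N m (x - \<delta>) < 0"
    using order_tendstoD(2)[OF lim neg] \<delta> by simp
  moreover have "\<forall>\<^sub>F m in sequentially. cycle_factor k N m (x + \<delta>) > 0"
    using order_tendstoD(1)[OF lim pos] \<delta> by simp
  ultimately have "\<forall>\<^sub>F m in sequentially. cycle_factor k N m (x - \<delta>) < 0 \<and> cycle_factor k N m (x + \<delta>) > 0 \<and> m \<ge> 2"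
    using eventually_ge_at_top[of 2] by eventually_elim auto
  then obtain m where m: "cycle_factor k N m (x - \<delta>) < 0" "cycle_factor k N m (x + \<delta>) > 0" "m \<ge> 2"
    by (auto simp: eventually_sequentially)
  have "continuous_on {x - \<delta>..x + \<delta>} (cycle_factor k N m)"
    using \<delta> by (intro cycle_factor_continuous) auto
  then obtain y where y: "x - \<delta> \<le> y" "y \<le> x + \<delta>" "cycle_factor k N m y = 0"
    using IVT'[of "cycle_factor k N m" "x - \<delta>" 0 "x + \<delta>"] m \<delta> by auto
  then have "cycle_factor k N m (complex_of_real y) = 0" by (simp add: cycle_factor_of_real)
  then have "complex_of_real y \<in> Z_simple"
    using y \<delta> m k0 N by (intro cycle_factor_root) auto
  then show ?thesis using y \<delta> by (intro exI[of _ y]) auto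
qed

lemma Z_simple_dense:
  assumes "q \<noteq> 0" "norm q < 1"
  shows "q \<in> closure Z_simple"
  unfolding closure_approachable
proof (intro allI impI)
  fix e :: real assume e: "e > 0"
  obtain k N q1 where k: "odd k" "N > 0" "of_nat N * q1 ^ k = - 1" "norm q1 < 1" "dist q1 q < e / 2"
    using dense_model_roots[OF assms, of "e / 2"] e by auto
  then obtain z where "z \<in> Z_simple" "dist z q1 < e / 2"
    using complex_root_near[of k N q1 "e / 2"] e odd_pos by auto
  moreover have "dist z q \<le> dist z q1 + dist q1 q" by (rule dist_triangle)
  ultimately show "\<exists>y\<in>Z_simple. dist y q < e" using k by (intro bexI[of _ z]) auto
qed

text \<open>The nearby model root \<open>q1\<close> need not be real, but \<open>- norm q1\<close>
  is also a model root because \<open>k\<close> is odd. As \<open>x < 0\<close>, it is at most as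
  far from \<open>x\<close> as \<open>q1\<close> is.\<close>

lemma Z_simple_real_dense:
  assumes "- 1 < x" "x < 0"
  shows "complex_of_real x \<in> closure (Z_simple \<inter> \<real>)"
  unfolding closure_approachable
proof (intro allI impI)
  fix e :: real assume e: "e > 0"
  obtain k N q1 where k: "odd k" "N > 0" "of_nat N * q1 ^ k = - 1" "norm q1 < 1"
      "dist q1 (complex_of_real x) < e / 2"
    using dense_model_roots[of "complex_of_real x" "e / 2"] e assms by auto
  have "norm (of_nat N * q1 ^ k) = 1" using k by simp
  then have "real N * (- norm q1) ^ k = - 1" using k(1) by (simp add: norm_mult norm_power)
  then obtain y where y: "complex_of_real y \<in> Z_simple" "\<bar>y - (- norm q1)\<bar> < e / 2"
    using real_root_near[of k N "- norm q1" "e / 2"] k e by auto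
  have "\<bar>norm q1 - norm (complex_of_real x)\<bar> \<le> norm (q1 - complex_of_real x)"
    by (rule norm_triangle_ineq3)
  then have "\<bar>norm q1 + x\<bar> < e / 2" using k(5) assms by (simp add: dist_norm)
  then have "\<bar>y - x\<bar> < e" using y by linarith
  then have "dist (complex_of_real y) (complex_of_real x) < e"
    by (simp add: dist_norm flip: of_real_diff)
  then show "\<exists>z\<in>Z_simple \<inter> \<real>. dist z (complex_of_real x) < e"
    using y by (intro bexI[of _ "complex_of_real y"]) auto
qed

text \<open>The single edge has reliability \<open>1 - q\<close>; at \<open>q = 1\<close> the weight
  is 0.\<close>

lemma one_in_Z_simple: "1 \<in> Z_simple"
proof -
  obtain V E where G: "simple_graph (V :: nat set) E" "connected_graph V E"
      "0 \<in> V" "1 \<in> V" "V \<inter> {} \<subseteq> {0, 1}" "{0, 1} \<in> E \<longrightarrow> True"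
      "conn_gf V E (0 :: complex) = 0" "subset_gf (splits V 0 1) E (0 :: complex) = 1"
    by (rule two_terminalE[OF two_terminal_edge[of 0] zero_neq_one finite.emptyI])
  then have "poly (rel_poly V E) 1 = 0"
    using poly_rel_poly[of E 1 V] simple_graph_finite[OF G(1)] by simp
  then show ?thesis using G unfolding Z_simple_def by blast
qed

theorem theorem1p1:
  shows "closure (ball 0 1) \<subseteq> closure Z_simple
    \<and> (complex_of_real ` {-1..0} \<subseteq> closure (Z_simple \<inter> \<real>)
       \<and> closure (Z_simple \<inter> \<real>) = complex_of_real ` ({-1..0} \<union> {1}))"
proof (intro conjI)
  have "ball 0 1 - {0} \<subseteq> closure Z_simple" by (auto intro!: Z_simple_dense)
  then have "closure (ball 0 1 - {0}) \<subseteq> closure Z_simple" by (rule closure_minimal) simp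
  \<comment> \<open>The point 0 was excluded from the substitution and is recovered as a limit point
    of the punctured disk.\<close>
  moreover have "closure (ball 0 1) \<subseteq> closure (ball 0 1 - {0 :: complex})"
  proof (rule closure_minimal)
    have "(0 :: complex) islimpt ball 0 1" by (rule interior_limit_point) simp
    then have "(0 :: complex) \<in> closure (ball 0 1 - {0})"
      by (simp add: closure_def islimpt_punctured[of 0 "ball 0 1"])
    then show "ball 0 1 \<subseteq> closure (ball 0 1 - {0 :: complex})"
      using closure_subset[of "ball 0 1 - {0 :: complex}"] by blast
  qed simp
  ultimately show "closure (ball 0 1) \<subseteq> closure Z_simple" by simp
  have "complex_of_real ` {-1<..<0} \<subseteq> closure (Z_simple \<inter> \<real>)" using Z_simple_real_dense by auto
  then have "closure (complex_of_real ` {-1<..<0}) \<subseteq> closure (Z_simple \<inter> \<real>)"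
    by (rule closure_minimal) simp
  moreover have "complex_of_real ` closure {-1<..<0} \<subseteq> closure (complex_of_real ` {-1<..<0})"
    by (intro continuous_image_closure_subset[of UNIV] continuous_intros) auto
  ultimately show sub: "complex_of_real ` {-1..0} \<subseteq> closure (Z_simple \<inter> \<real>)" by simp
  show "closure (Z_simple \<inter> \<real>) = complex_of_real ` ({-1..0} \<union> {1})"
  proof
    have "Z_simple \<inter> \<real> \<subseteq> complex_of_real ` ({-1..0} \<union> {1})"
    proof
      fix q assume "q \<in> Z_simple \<inter> \<real>"
      then obtain x V E where "q = complex_of_real x" "simple_graph (V :: nat set) E" "connected_graph V E"
          "poly (rel_poly V E) (complex_of_real x) = 0"
        by (auto simp: Z_simple_def elim!: Reals_cases)
      then show "q \<in> complex_of_real ` ({-1..0} \<union> {1})" using real_root_range by blast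
    qed
    \<comment> \<open>Compactness makes the image closed, so the upper bound on the set of real
      roots passes to its closure.\<close>
    moreover have "compact (complex_of_real ` ({-1..0} \<union> {1}))"
      by (intro compact_continuous_image continuous_intros) auto
    ultimately show "closure (Z_simple \<inter> \<real>) \<subseteq> complex_of_real ` ({-1..0} \<union> {1})"
      by (intro closure_minimal compact_imp_closed)
    have "complex_of_real 1 \<in> closure (Z_simple \<inter> \<real>)"
      using one_in_Z_simple closure_subset[of "Z_simple \<inter> \<real>"] by auto
    then show "complex_of_real ` ({-1..0} \<union> {1}) \<subseteq> closure (Z_simple \<inter> \<real>)" using sub by auto
  qed
qed

end
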